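(* Let $0\le b<a$. For $b\le x<a$, $$Z^{\downarrow}_a(x,b)=Z^{\downarrow}(x,b)-Z^{\uparrow}_b(x,a)\,Z^{\downarrow}(a,b).$$
   Context: Model. Let $E=\{1,\dots,m\}$; for each $i\in E$ let $c_i>0$, $\lambda_i>0$, $p_i\in(0,1)$, and let $Q=(q_{ij})_{i,j\in E}$ be a stochastic matrix. $(X,J)$ is the Markov process on $[0,\infty)\times E$ with the following dynamics: while the phase $J$ equals $i$, the level $X$ increases linearly with slope $1/c_i$ and the next jump occurs at rate $\lambda_i$; at a jump from $(x,i)$ the process moves to $(p_i x,j)$ with probability $q_{ij}$ ($j=i$ is allowed). $\mathbb E_{x,i}$ denotes expectation given $(X(0),J(0))=(x,i)$. Fix $w>0$. Let $\tau_{\uparrow a}=\inf\{t\ge0:X(t)\ge a\}$ and $\tau_{\downarrow b}=\inf\{t\ge0:X(t)\le b\}$. Define matrices by (infinite times contribute $0$) $$Z^{\downarrow}_{ij}(x,b)=\mathbb E_{x,i}[e^{-w\tau_{\downarrow b}};J(\tau_{\downarrow b})=j],$$ $$(Z^{\uparrow}_b)_{ij}(x,a)=\mathbb E_{x,i}[e^{-w\tau_{\uparrow a}};\tau_{\uparrow a}<\tau_{\downarrow b},J(\tau_{\uparrow a})=j],$$ $$(Z^{\downarrow}_a)_{ij}(x,b)=\mathbb E_{x,i}[e^{-w\tau_{\downarrow b}};\tau_{\downarrow b}<\tau_{\uparrow a},J(\tau_{\downarrow b})=j],$$ with $Z^{\uparrow}_b(x,a)=0$ for $x\le b$. *)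

theory Defs
  imports "HOL-Probability.Probability"
begin

definition stochastic_matrix :: "real^'e^'e \<Rightarrow> bool" where
  "stochastic_matrix Q \<longleftrightarrow> (\<forall>i j. 0 \<le> Q $ i $ j) \<and> (\<forall>i. (\<Sum>j\<in>UNIV. Q $ i $ j) = 1)"

text \<open>
  The phases form a finite type, and the process is built from its jump chain and holding times.
  The sample space consists of independent entries indexed by \<open>(n, i)\<close>. The entry
  \<open>(\<omega> !! n) i\<close> is a pair made of an exponential holding time with rate \<open>lam i\<close> and a next
  phase with distribution \<open>Q $ i\<close>; it is used if the process is in phase \<open>i\<close> after its
  \<open>n\<close>-th jump, and ignored otherwise. The function \<open>embed_pmf\<close> has the intended meaning
  only if \<open>Q\<close> is a stochastic matrix.
\<close>

type_synonym 'e sample = "('e \<Rightarrow> real \<times> 'e) stream"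

definition sample_measure :: "('e::finite \<Rightarrow> real) \<Rightarrow> real^'e^'e \<Rightarrow> 'e sample measure" where
  "sample_measure lam Q =
     stream_space (\<Pi>\<^sub>M i\<in>UNIV.
       density lborel (exponential_density (lam i)) \<Otimes>\<^sub>M measure_pmf (embed_pmf (\<lambda>j. Q $ i $ j)))"

text \<open>The jump chain: phase, holding time and level just after the \<open>n\<close>-th jump, and the
  time of that jump, for the initial state \<open>(x, i)\<close>; index \<open>0\<close> refers to time \<open>0\<close>.\<close>

primrec chain_phase :: "'e \<Rightarrow> 'e sample \<Rightarrow> nat \<Rightarrow> 'e" where
  "chain_phase i \<omega> 0 = i"
| "chain_phase i \<omega> (Suc n) = snd ((\<omega> !! n) (chain_phase i \<omega> n))"

definition holding_time :: "'e \<Rightarrow> 'e sample \<Rightarrow> nat \<Rightarrow> real" where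
  "holding_time i \<omega> n = fst ((\<omega> !! n) (chain_phase i \<omega> n))"

definition jump_time :: "'e \<Rightarrow> 'e sample \<Rightarrow> nat \<Rightarrow> real" where
  "jump_time i \<omega> n = (\<Sum>k<n. holding_time i \<omega> k)"

primrec chain_level ::
  "('e \<Rightarrow> real) \<Rightarrow> ('e \<Rightarrow> real) \<Rightarrow> real \<Rightarrow> 'e \<Rightarrow> 'e sample \<Rightarrow> nat \<Rightarrow> real" where
  "chain_level c p x i \<omega> 0 = x"
| "chain_level c p x i \<omega> (Suc n) =
     p (chain_phase i \<omega> n) *
       (chain_level c p x i \<omega> n + holding_time i \<omega> n / c (chain_phase i \<omega> n))"

definition num_jumps :: "'e \<Rightarrow> 'e sample \<Rightarrow> real \<Rightarrow> nat" where
  "num_jumps i \<omega> t = (LEAST n. t < jump_time i \<omega> (Suc n))"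

text \<open>The process started in \<open>(x, i)\<close>. The \<open>else\<close> branches concern times after
  infinitely many jumps. Since the phase space is finite, this has probability zero, and the
  values given there are immaterial.\<close>

definition level ::
  "('e \<Rightarrow> real) \<Rightarrow> ('e \<Rightarrow> real) \<Rightarrow> real \<Rightarrow> 'e \<Rightarrow> 'e sample \<Rightarrow> real \<Rightarrow> real" where
  "level c p x i \<omega> t =
     (if \<exists>n. t < jump_time i \<omega> (Suc n)
      then let n = num_jumps i \<omega> t
           in chain_level c p x i \<omega> n + (t - jump_time i \<omega> n) / c (chain_phase i \<omega> n)
      else 0)"

definition phase :: "'e \<Rightarrow> 'e sample \<Rightarrow> real \<Rightarrow> 'e" where
  "phase i \<omega> t =
     (if \<exists>n. t < jump_time i \<omega> (Suc n) then chain_phase i \<omega> (num_jumps i \<omega> t) else i)"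

text \<open>Hitting times are extended reals; \<open>Inf {} = \<infinity>\<close>.\<close>

definition hit_up ::
  "('e \<Rightarrow> real) \<Rightarrow> ('e \<Rightarrow> real) \<Rightarrow> real \<Rightarrow> 'e \<Rightarrow> real \<Rightarrow> 'e sample \<Rightarrow> ereal" where
  "hit_up c p x i a \<omega> = Inf {ereal t |t. 0 \<le> t \<and> a \<le> level c p x i \<omega> t}"

definition hit_down ::
  "('e \<Rightarrow> real) \<Rightarrow> ('e \<Rightarrow> real) \<Rightarrow> real \<Rightarrow> 'e \<Rightarrow> real \<Rightarrow> 'e sample \<Rightarrow> ereal" where
  "hit_down c p x i b \<omega> = Inf {ereal t |t. 0 \<le> t \<and> level c p x i \<omega> t \<le> b}"

text \<open>The integrand \<open>e\<^bsup>-w \<tau>\<^esup>; J(\<tau>) = j\<close>, which is \<open>0\<close> if \<open>\<tau>\<close> is infinite.\<close>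

definition discounted :: "real \<Rightarrow> 'e \<Rightarrow> 'e \<Rightarrow> ereal \<Rightarrow> 'e sample \<Rightarrow> real" where
  "discounted w i j \<tau> \<omega> =
     (if \<tau> < \<infinity> \<and> phase i \<omega> (real_of_ereal \<tau>) = j then exp (- w * real_of_ereal \<tau>) else 0)"

definition Z_down ::
  "('e::finite \<Rightarrow> real) \<Rightarrow> ('e \<Rightarrow> real) \<Rightarrow> ('e \<Rightarrow> real) \<Rightarrow> real^'e^'e \<Rightarrow> real
     \<Rightarrow> real \<Rightarrow> real \<Rightarrow> real^'e^'e" where
  "Z_down c lam p Q w x b =
     (\<chi> i j. \<integral>\<omega>. discounted w i j (hit_down c p x i b \<omega>) \<omega> \<partial>sample_measure lam Q)"

text \<open>The parameter \<open>b\<close> of \<open>Z_up_before\<close> and the parameter \<open>a\<close> of \<open>Z_down_before\<close>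
  are the subscripts in \<open>Z\<^sup>\<up>\<^sub>b(x, a)\<close> and \<open>Z\<^sup>\<down>\<^sub>a(x, b)\<close>. For \<open>x \<le> b\<close> the downward hitting
  time is almost surely \<open>0\<close>, so the convention \<open>Z\<^sup>\<up>\<^sub>b(x, a) = 0\<close> holds without a separate case.\<close>

definition Z_up_before ::
  "('e::finite \<Rightarrow> real) \<Rightarrow> ('e \<Rightarrow> real) \<Rightarrow> ('e \<Rightarrow> real) \<Rightarrow> real^'e^'e \<Rightarrow> real
     \<Rightarrow> real \<Rightarrow> real \<Rightarrow> real \<Rightarrow> real^'e^'e" where
  "Z_up_before c lam p Q w b x a =
     (\<chi> i j. \<integral>\<omega>. (if hit_up c p x i a \<omega> < hit_down c p x i b \<omega>
                 then discounted w i j (hit_up c p x i a \<omega>) \<omega> else 0) \<partial>sample_measure lam Q)"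

definition Z_down_before ::
  "('e::finite \<Rightarrow> real) \<Rightarrow> ('e \<Rightarrow> real) \<Rightarrow> ('e \<Rightarrow> real) \<Rightarrow> real^'e^'e \<Rightarrow> real
     \<Rightarrow> real \<Rightarrow> real \<Rightarrow> real \<Rightarrow> real^'e^'e" where
  "Z_down_before c lam p Q w a x b =
     (\<chi> i j. \<integral>\<omega>. (if hit_down c p x i b \<omega> < hit_up c p x i a \<omega>
                 then discounted w i j (hit_down c p x i b \<omega>) \<omega> else 0) \<partial>sample_measure lam Q)"

end

theory Submission
  imports Defs
begin

text \<open>
  The identity is proved by first-step analysis instead of the strong Markov property at the passage
  time of level \<open>a\<close>. Conditioning on the first holding time and the next phase expresses each of the
  transforms at \<open>(x, i)\<close> through its values just after the first jump. If \<open>a\<close> is crossed before that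
  jump, memorylessness of the exponential distribution turns the corresponding part of
  \<open>Z\<^sup>\<down>(x, b)\<close> into a multiple of \<open>Z\<^sup>\<down>(a, b)\<close>, the multiple being the probability-weighted discount
  that also appears in \<open>Z\<^sup>\<up>\<^sub>b(x, a)\<close>. Hence the difference \<open>D\<close> of the two sides solves, for
  \<open>b < x < a\<close>, a homogeneous equation \<open>D(x, i) = E[e\<^bsup>-wH\<^esup> D(x', j'); no crossing of a]\<close>, and it
  vanishes for \<open>x \<le> b\<close>. Since \<open>E[e\<^bsup>-wH\<^esup>]\<close> is bounded by some \<open>r < 1\<close> and \<open>D\<close> is bounded,
  \<open>\<bar>D\<bar>\<close> is at most a constant times \<open>r ^ n\<close> for every \<open>n\<close>, so \<open>D = 0\<close>.
\<close>

section \<open>Measurability\<close>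

definition step_measure :: "('e::finite \<Rightarrow> real) \<Rightarrow> real^'e^'e \<Rightarrow> 'e \<Rightarrow> (real \<times> 'e) measure" where
  "step_measure lam Q i =
     density lborel (exponential_density (lam i)) \<Otimes>\<^sub>M measure_pmf (embed_pmf (\<lambda>j. Q $ i $ j))"

definition entry_measure :: "('e::finite \<Rightarrow> real) \<Rightarrow> real^'e^'e \<Rightarrow> ('e \<Rightarrow> real \<times> 'e) measure" where
  "entry_measure lam Q = (\<Pi>\<^sub>M i\<in>UNIV. step_measure lam Q i)"

lemma sample_measure_eq: "sample_measure lam Q = stream_space (entry_measure lam Q)"
  by (simp add: sample_measure_def entry_measure_def step_measure_def)

text \<open>The first factor is a density over Lebesgue measure and the second a
  \<open>measure_pmf\<close>, so neither \<open>lam\<close> nor \<open>Q\<close> affects the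
  measurable sets, and measurability can be checked against one fixed product.\<close>

lemma sets_step_measure [measurable_cong]:
  "sets (step_measure lam Q i) = sets (borel \<Otimes>\<^sub>M count_space UNIV)"
  unfolding step_measure_def by (intro sets_pair_measure_cong) auto

lemma space_step_measure [simp]: "space (step_measure lam Q i) = UNIV"
  using sets_eq_imp_space_eq[OF sets_step_measure] by (simp add: space_pair_measure)

lemma space_entry_measure [simp]: "space (entry_measure lam Q) = UNIV"
  by (simp add: entry_measure_def space_PiM)

lemma space_sample_measure [simp]: "space (sample_measure lam Q) = UNIV"
  by (simp add: sample_measure_eq space_stream_space)

lemma measurable_component:
  assumes "g \<in> N \<rightarrow>\<^sub>M entry_measure lam Q"
  shows "(\<lambda>z. g z i) \<in> N \<rightarrow>\<^sub>M borel \<Otimes>\<^sub>M count_space UNIV"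
  using measurable_compose[OF assms[unfolded entry_measure_def] measurable_component_singleton[of i UNIV]]
  by (simp cong: measurable_cong_sets add: sets_step_measure)

lemma measurable_entry [measurable (raw)]:
  assumes "g \<in> N \<rightarrow>\<^sub>M sample_measure lam Q"
  shows "(\<lambda>z. (g z !! n)) \<in> N \<rightarrow>\<^sub>M entry_measure lam Q"
  using assms unfolding sample_measure_eq by measurable

lemma measurable_entry_component [measurable (raw)]:
  "g \<in> N \<rightarrow>\<^sub>M sample_measure lam Q \<Longrightarrow> (\<lambda>z. (g z !! n) i) \<in> N \<rightarrow>\<^sub>M borel \<Otimes>\<^sub>M count_space UNIV"
  by (intro measurable_component measurable_entry)

lemma measurable_sample_Stream [measurable (raw)]:
  assumes "f \<in> N \<rightarrow>\<^sub>M entry_measure lam Q" "g \<in> N \<rightarrow>\<^sub>M sample_measure lam Q"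
  shows "(\<lambda>z. f z ## g z) \<in> N \<rightarrow>\<^sub>M sample_measure lam Q"
  using assms unfolding sample_measure_eq by measurable

text \<open>The component read at step \<open>n\<close> is selected by the current phase, which is
  itself random; with finitely many phases this is a countable case split over measurable
  components. The initial phase may vary measurably because after the first jump the process
  restarts from a random phase.\<close>

lemma measurable_chain_phase [measurable (raw)]:
  assumes [measurable]: "k \<in> N \<rightarrow>\<^sub>M count_space UNIV" "g \<in> N \<rightarrow>\<^sub>M sample_measure lam Q"
  shows "(\<lambda>z. chain_phase (k z) (g z) n) \<in> N \<rightarrow>\<^sub>M count_space UNIV"
proof (induction n)
  case (Suc n)
  note Suc [measurable]
  show ?case
    unfolding chain_phase.simps
    by (rule measurable_compose_countable[where f="\<lambda>j z. snd ((g z !! n) j)", OF _ Suc]) measurable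
qed simp

lemma measurable_holding_time [measurable (raw)]:
  assumes [measurable]: "k \<in> N \<rightarrow>\<^sub>M count_space UNIV" "g \<in> N \<rightarrow>\<^sub>M sample_measure lam Q"
  shows "(\<lambda>z. holding_time (k z) (g z) n) \<in> borel_measurable N"
  unfolding holding_time_def
  by (rule measurable_compose_countable[where f="\<lambda>j z. fst ((g z !! n) j)"]) measurable

lemma measurable_jump_time [measurable (raw)]:
  assumes [measurable]: "k \<in> N \<rightarrow>\<^sub>M count_space UNIV" "g \<in> N \<rightarrow>\<^sub>M sample_measure lam Q"
  shows "(\<lambda>z. jump_time (k z) (g z) n) \<in> borel_measurable N"
  unfolding jump_time_def by measurable

lemma measurable_chain_level [measurable (raw)]:
  assumes [measurable]: "x \<in> borel_measurable N" "k \<in> N \<rightarrow>\<^sub>M count_space UNIV"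
    "g \<in> N \<rightarrow>\<^sub>M sample_measure lam Q"
  shows "(\<lambda>z. chain_level c p (x z) (k z) (g z) n) \<in> borel_measurable N"
proof (induction n)
  case (Suc n)
  note Suc [measurable]
  have [measurable]: "c \<in> count_space UNIV \<rightarrow>\<^sub>M borel" "p \<in> count_space UNIV \<rightarrow>\<^sub>M borel"
    by simp_all
  show ?case
    unfolding chain_level.simps by measurable
qed simp

lemma measurable_num_jumps [measurable (raw)]:
  assumes [measurable]: "t \<in> borel_measurable N" "k \<in> N \<rightarrow>\<^sub>M count_space UNIV"
    "g \<in> N \<rightarrow>\<^sub>M sample_measure lam Q"
  shows "(\<lambda>z. num_jumps (k z) (g z) (t z)) \<in> N \<rightarrow>\<^sub>M count_space UNIV"
  unfolding num_jumps_def by measurable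

lemma measurable_level [measurable (raw)]:
  assumes [measurable]: "x \<in> borel_measurable N" "t \<in> borel_measurable N"
    "k \<in> N \<rightarrow>\<^sub>M count_space UNIV" "g \<in> N \<rightarrow>\<^sub>M sample_measure lam Q"
  shows "(\<lambda>z. level c p (x z) (k z) (g z) (t z)) \<in> borel_measurable N"
proof -
  have [measurable]: "c \<in> count_space UNIV \<rightarrow>\<^sub>M borel"
    by simp
  have "(\<lambda>z. chain_level c p (x z) (k z) (g z) (num_jumps (k z) (g z) (t z)) +
          (t z - jump_time (k z) (g z) (num_jumps (k z) (g z) (t z))) /
            c (chain_phase (k z) (g z) (num_jumps (k z) (g z) (t z)))) \<in> borel_measurable N"
    by (rule measurable_compose_countable[where g="\<lambda>z. num_jumps (k z) (g z) (t z)"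
        and f="\<lambda>n z. chain_level c p (x z) (k z) (g z) n +
          (t z - jump_time (k z) (g z) n) / c (chain_phase (k z) (g z) n)"]) measurable
  then show ?thesis
    unfolding level_def Let_def by measurable
qed

lemma measurable_phase [measurable (raw)]:
  assumes [measurable]: "t \<in> borel_measurable N"
    "k \<in> N \<rightarrow>\<^sub>M count_space UNIV" "g \<in> N \<rightarrow>\<^sub>M sample_measure lam Q"
  shows "(\<lambda>z. phase (k z) (g z) (t z)) \<in> N \<rightarrow>\<^sub>M count_space UNIV"
proof -
  have [measurable]: "(\<lambda>z. chain_phase (k z) (g z) (num_jumps (k z) (g z) (t z))) \<in> N \<rightarrow>\<^sub>M count_space UNIV"
    by (rule measurable_compose_countable[where g="\<lambda>z. num_jumps (k z) (g z) (t z)"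
        and f="\<lambda>n z. chain_phase (k z) (g z) n"]) measurable
  show ?thesis
    unfolding phase_def by measurable
qed

text \<open>All jump times up to index \<open>n\<close> have to be compared with \<open>t\<close>,
  not only the last one: they need not be monotone on the null set where holding times are
  negative.\<close>

lemma num_jumps_eqI:
  assumes "t < jump_time i \<omega> (Suc n)" "\<And>m. m \<le> n \<Longrightarrow> jump_time i \<omega> m \<le> t"
  shows "num_jumps i \<omega> t = n"
  unfolding num_jumps_def
proof (rule Least_equality)
  show "t < jump_time i \<omega> (Suc n)"
    by (rule assms)
  fix m assume "t < jump_time i \<omega> (Suc m)"
  then show "n \<le> m"
    using assms(2)[of "Suc m"] by (meson leD not_less_eq_eq)
qed

lemma num_jumps_bounds:
  assumes "0 \<le> t" "t < jump_time i \<omega> (Suc n)"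
  shows "t < jump_time i \<omega> (Suc (num_jumps i \<omega> t))"
    and "m \<le> num_jumps i \<omega> t \<Longrightarrow> jump_time i \<omega> m \<le> t"
proof -
  show "t < jump_time i \<omega> (Suc (num_jumps i \<omega> t))"
    unfolding num_jumps_def by (rule LeastI[of _ n]) (use assms in auto)
  assume "m \<le> num_jumps i \<omega> t"
  then show "jump_time i \<omega> m \<le> t"
    \<comment> \<open>For \<open>m > 0\<close> the index \<open>m - 1\<close> is below the least
      one, so jump \<open>m\<close> is not after \<open>t\<close>; for \<open>m = 0\<close> the
      claim is \<open>0 \<le> t\<close>.\<close>
    using assms(1) not_less_Least[of "m - 1" "\<lambda>n. t < jump_time i \<omega> (Suc n)"]
    by (cases m) (auto simp: num_jumps_def jump_time_def)
qed

lemma ex_rat_between_ereal: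
  assumes "ereal t < r"
  shows "\<exists>q. t < of_rat q \<and> ereal (of_rat q) < r"
proof -
  obtain z where z: "ereal t < ereal z" "ereal z < r"
    using assms ereal_dense2 by blast
  then obtain q where "t < of_rat q" "of_rat q < z"
    using of_rat_dense[of t z] by auto
  then show ?thesis
    using z by (intro exI[of _ q] conjI) (auto intro: less_trans[of _ "ereal z"])
qed

section \<open>Passage times: the path between jumps and measurability\<close>

locale fluid_model =
  fixes c lam p :: "'e::finite \<Rightarrow> real" and Q :: "real^'e^'e"
  assumes c_pos: "0 < c i" and lam_pos: "0 < lam i" and p_pos: "0 < p i" and p_less_1: "p i < 1"
begin

abbreviation "S \<equiv> sample_measure lam Q"

text \<open>Both times lie after jumps \<open>0\<close> to \<open>n\<close> and before jump
  \<open>n + 1\<close>, so \<open>num_jumps\<close> is \<open>n\<close> at both and the level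
  follows a single line of positive slope.\<close>

lemma level_mono_between_jumps:
  assumes "t < jump_time i \<omega> (Suc n)" "\<And>m. m \<le> n \<Longrightarrow> jump_time i \<omega> m \<le> s" "s \<le> t"
  shows "level c p x i \<omega> s \<le> level c p x i \<omega> t"
proof -
  have "num_jumps i \<omega> t = n" "num_jumps i \<omega> s = n"
    using assms by (auto intro!: num_jumps_eqI intro: order_trans)
  moreover have "(s - jump_time i \<omega> n) / c (chain_phase i \<omega> n) \<le> (t - jump_time i \<omega> n) / c (chain_phase i \<omega> n)"
    using assms(3) c_pos by (intro divide_right_mono) (auto intro: less_imp_le)
  moreover have "s < jump_time i \<omega> (Suc n)"
    using assms by auto
  ultimately show ?thesis
    using assms(1) by (auto simp: level_def Let_def)
qed

lemma level_explosive:
  assumes "\<And>n. jump_time i \<omega> (Suc n) \<le> t" "t \<le> s"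
  shows "level c p x i \<omega> s = level c p x i \<omega> t"
proof -
  have "\<not> t < jump_time i \<omega> (Suc n)" "\<not> s < jump_time i \<omega> (Suc n)" for n
    using assms(1)[of n] assms(2) by auto
  then show ?thesis
    by (simp add: level_def)
qed

text \<open>The level increases between jumps and is right-continuous, so passage above \<open>a\<close> is detected
  at rational times, while passage below \<open>b\<close> is detected at the left ends of the intervals between
  jumps, or at rational times after an explosion. This yields measurability on the whole sample
  space, including the null set where holding times are negative.\<close>

lemma hit_up_less_iff:
  "hit_up c p x i a \<omega> < r \<longleftrightarrow>
     (\<exists>q. 0 \<le> real_of_rat q \<and> ereal (of_rat q) < r \<and> a \<le> level c p x i \<omega> (of_rat q))"
proof
  assume "hit_up c p x i a \<omega> < r"
  then obtain t where t: "0 \<le> t" "a \<le> level c p x i \<omega> t" "ereal t < r"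
    unfolding hit_up_def Inf_less_iff by auto
  show "\<exists>q. 0 \<le> real_of_rat q \<and> ereal (of_rat q) < r \<and> a \<le> level c p x i \<omega> (of_rat q)"
  proof (cases "\<exists>n. t < jump_time i \<omega> (Suc n)")
    case True
    then obtain n where n: "t < jump_time i \<omega> (Suc n)" "\<And>m. m \<le> n \<Longrightarrow> jump_time i \<omega> m \<le> t"
      using num_jumps_bounds[OF t(1)] by metis
    then obtain q where q: "t < of_rat q" "ereal (of_rat q) < min r (ereal (jump_time i \<omega> (Suc n)))"
      using ex_rat_between_ereal[of t "min r (ereal (jump_time i \<omega> (Suc n)))"] t by auto
    then have "level c p x i \<omega> t \<le> level c p x i \<omega> (of_rat q)"
      using n by (intro level_mono_between_jumps) auto
    moreover have "0 \<le> real_of_rat q"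
      using q t by linarith
    ultimately show ?thesis
      using q t by (intro exI[of _ q]) (auto simp del: zero_le_of_rat_iff)
  next
    case False
    obtain q where q: "t < of_rat q" "ereal (of_rat q) < r"
      using ex_rat_between_ereal[OF t(3)] by auto
    moreover have "0 \<le> real_of_rat q"
      using q t by linarith
    ultimately show ?thesis
      using t level_explosive[of i \<omega> t "of_rat q" x] False
      by (intro exI[of _ q]) (auto simp: not_less simp del: zero_le_of_rat_iff)
  qed
next
  assume "\<exists>q. 0 \<le> real_of_rat q \<and> ereal (of_rat q) < r \<and> a \<le> level c p x i \<omega> (of_rat q)"
  then show "hit_up c p x i a \<omega> < r"
    unfolding hit_up_def Inf_less_iff by blast
qed

lemma hit_down_less_iff:
  "hit_down c p x i b \<omega> < r \<longleftrightarrow>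
     (\<exists>q. 0 \<le> real_of_rat q \<and> ereal (of_rat q) < r \<and> level c p x i \<omega> (of_rat q) \<le> b) \<or>
     (\<exists>n. 0 \<le> jump_time i \<omega> n \<and> ereal (jump_time i \<omega> n) < r \<and>
        level c p x i \<omega> (jump_time i \<omega> n) \<le> b)" (is "_ \<longleftrightarrow> ?R")
proof
  assume "hit_down c p x i b \<omega> < r"
  then obtain t where t: "0 \<le> t" "level c p x i \<omega> t \<le> b" "ereal t < r"
    unfolding hit_down_def Inf_less_iff by auto
  show ?R
  proof (cases "\<exists>n. t < jump_time i \<omega> (Suc n)")
    case True
    then obtain n where n: "t < jump_time i \<omega> (Suc n)" "\<And>m. m \<le> n \<Longrightarrow> jump_time i \<omega> m \<le> t"
      using num_jumps_bounds[OF t(1)] by metis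
    \<comment> \<open>The left end of the interval around \<open>t\<close> is the largest of the
      first \<open>n + 1\<close> jump times, which need not be the one with index \<open>n\<close>
      when holding times are negative.\<close>
    obtain k where k: "k \<le> n" "\<And>m. m \<le> n \<Longrightarrow> jump_time i \<omega> m \<le> jump_time i \<omega> k"
      using Max_in[of "jump_time i \<omega> ` {..n}"] Max_ge[of "jump_time i \<omega> ` {..n}"] by fastforce
    have "level c p x i \<omega> (jump_time i \<omega> k) \<le> level c p x i \<omega> t"
      using n k by (intro level_mono_between_jumps) auto
    moreover have "0 \<le> jump_time i \<omega> k"
      using k(2)[of 0] by (simp add: jump_time_def)
    moreover have "ereal (jump_time i \<omega> k) < r"
      using n(2)[OF k(1)] t(3) by (meson ereal_less_eq(3) le_less_trans)
    ultimately show ?thesis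
      using t by force
  next
    case False
    obtain q where q: "t < of_rat q" "ereal (of_rat q) < r"
      using ex_rat_between_ereal[OF t(3)] by auto
    moreover have "0 \<le> real_of_rat q"
      using q t by linarith
    ultimately show ?thesis
      using t level_explosive[of i \<omega> t "of_rat q" x] False
      by (intro disjI1 exI[of _ q]) (auto simp: not_less simp del: zero_le_of_rat_iff)
  qed
next
  assume ?R
  then show "hit_down c p x i b \<omega> < r"
    unfolding hit_down_def Inf_less_iff by blast
qed

lemma measurable_hit_up [measurable (raw)]:
  assumes [measurable]: "x \<in> borel_measurable N"
    "k \<in> N \<rightarrow>\<^sub>M count_space UNIV" "g \<in> N \<rightarrow>\<^sub>M S"
  shows "(\<lambda>z. hit_up c p (x z) (k z) a (g z)) \<in> borel_measurable N"
  by (rule borel_measurableI_less) (simp add: hit_up_less_iff)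

lemma measurable_hit_down [measurable (raw)]:
  assumes [measurable]: "x \<in> borel_measurable N"
    "k \<in> N \<rightarrow>\<^sub>M count_space UNIV" "g \<in> N \<rightarrow>\<^sub>M S"
  shows "(\<lambda>z. hit_down c p (x z) (k z) b (g z)) \<in> borel_measurable N"
  by (rule borel_measurableI_less) (simp add: hit_down_less_iff)

lemma measurable_discounted [measurable (raw)]:
  assumes [measurable]: "\<tau> \<in> borel_measurable N"
    "k \<in> N \<rightarrow>\<^sub>M count_space UNIV" "g \<in> N \<rightarrow>\<^sub>M S"
  shows "(\<lambda>z. discounted w (k z) j (\<tau> z) (g z)) \<in> borel_measurable N"
  unfolding discounted_def by measurable

end

section \<open>The first step\<close>

lemma integral_exponential_shift:
  fixes g :: "real \<Rightarrow> real"
  assumes l: "0 < l" and u: "0 \<le> u" and [measurable]: "g \<in> borel_measurable borel"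
  shows "(\<integral>h. (if u < h then g (h - u) else 0) \<partial>density lborel (exponential_density l)) =
           exp (- l * u) * (\<integral>h. g h \<partial>density lborel (exponential_density l))"
proof -
  have "(\<integral>h. (if u < h then g (h - u) else 0) \<partial>density lborel (exponential_density l)) =
          (\<integral>h. exponential_density l h * (if u < h then g (h - u) else 0) \<partial>lborel)"
    using exponential_density_nonneg[OF l] by (subst integral_density) auto
  \<comment> \<open>Translation by \<open>u\<close>, under which Lebesgue measure is
    invariant.\<close>
  also have "\<dots> = (\<integral>h. exponential_density l (u + h) * (if 0 < h then g h else 0) \<partial>lborel)"
    by (subst lborel_integral_real_affine[where c=1 and t=u])
       (auto intro!: Bochner_Integration.integral_cong)
  \<comment> \<open>For \<open>h > 0\<close> the density at \<open>u + h\<close> is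
    \<open>exp (- l * u)\<close> times the density at \<open>h\<close>; for \<open>h < 0\<close>
    both sides vanish, and the point \<open>h = 0\<close>, where they may differ, is null.\<close>
  also have "\<dots> = (\<integral>h. exp (- l * u) * (exponential_density l h * g h) \<partial>lborel)"
  proof (rule integral_cong_AE)
    have "AE h in lborel. h \<noteq> (0::real)"
      by (rule AE_lborel_singleton)
    then show "AE h in lborel. exponential_density l (u + h) * (if 0 < h then g h else 0) =
        exp (- l * u) * (exponential_density l h * g h)"
      by eventually_elim (use u in \<open>auto simp: exponential_density_def algebra_simps exp_add[symmetric]\<close>)
  qed measurable
  also have "\<dots> = exp (- l * u) * (\<integral>h. g h \<partial>density lborel (exponential_density l))"
    using exponential_density_nonneg[OF l] by (subst integral_density) auto
  finally show ?thesis .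
qed

text \<open>Multiplying the density of rate \<open>l\<close> by \<open>exp (- w * h)\<close> gives
  \<open>l / (l + w)\<close> times the density of rate \<open>l + w\<close>, which has total mass
  \<open>1\<close>.\<close>

lemma integral_exponential_exp:
  assumes l: "0 < l" and w: "0 < w"
  shows "(\<integral>h. exp (- w * h) \<partial>density lborel (exponential_density l)) = l / (l + w)"
proof -
  have "exponential_density l h * exp (- w * h) = l / (l + w) * exponential_density (l + w) h" for h
  proof -
    have "exp (- h * l) * exp (- w * h) = exp (- h * (l + w))"
      by (simp add: mult_exp_exp algebra_simps)
    moreover have "l + w \<noteq> 0"
      using l w by simp
    ultimately show ?thesis
      by (simp add: exponential_density_def)
  qed
  then have "(\<integral>h. exp (- w * h) \<partial>density lborel (exponential_density l)) =
          (\<integral>h. l / (l + w) * exponential_density (l + w) h \<partial>lborel)"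
    using exponential_density_nonneg[OF l] by (subst integral_density) auto
  also have "\<dots> = l / (l + w) * (\<integral>h. 1 \<partial>density lborel (exponential_density (l + w)))"
    using exponential_density_nonneg[of "l + w"] l w by (subst integral_density) auto
  also have "(\<integral>h. 1 \<partial>density lborel (exponential_density (l + w))) = (1::real)"
  proof -
    interpret prob_space "density lborel (exponential_density (l + w))"
      by (rule prob_space_exponential_density) (use l w in auto)
    show ?thesis
      using prob_space by simp
  qed
  finally show ?thesis
    by simp
qed

text \<open>Entry \<open>n\<close> of the tail is entry \<open>Suc n\<close> of the whole stream, so
  dropping the first entry and starting in the phase it selects reproduces the rest of the chain.
  This index shift, a pathwise form of the Markov property, also underlies the versions for holding
  times, jump times and levels.\<close>

lemma chain_phase_Stream: "chain_phase i (y ## s) (Suc n) = chain_phase (snd (y i)) s n"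
  by (induction n) auto

lemma holding_time_Stream:
  "holding_time i (y ## s) 0 = fst (y i)"
  "holding_time i (y ## s) (Suc n) = holding_time (snd (y i)) s n"
  by (simp_all add: holding_time_def chain_phase_Stream del: chain_phase.simps(2))

lemma jump_time_Stream: "jump_time i (y ## s) (Suc n) = fst (y i) + jump_time (snd (y i)) s n"
  unfolding jump_time_def by (subst sum.lessThan_Suc_shift) (simp add: holding_time_Stream)

lemma chain_level_Stream:
  "chain_level c p x i (y ## s) (Suc n) =
     chain_level c p (p i * (x + fst (y i) / c i)) (snd (y i)) s n"
proof (induction n)
  case 0
  show ?case
    by (simp add: holding_time_Stream)
next
  case (Suc n)
  show ?case
    by (subst (1) chain_level.simps(2), subst Suc) (simp add: holding_time_Stream chain_phase_Stream del: chain_phase.simps(2))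
qed

text \<open>Unboundedness of the jump times. It keeps \<open>level\<close> and \<open>phase\<close>
  out of their \<open>else\<close> branches and guarantees a witness for the \<open>LEAST\<close> in
  \<open>num_jumps\<close>.\<close>

definition nonexplosive :: "'e \<Rightarrow> 'e sample \<Rightarrow> bool" where
  "nonexplosive i \<omega> \<longleftrightarrow> (\<forall>t. \<exists>n. t < jump_time i \<omega> (Suc n))"

section \<open>Integration over the first entry and absence of explosion\<close>

context fluid_model
begin

abbreviation "\<mu> \<equiv> entry_measure lam Q"
abbreviation "\<nu> \<equiv> step_measure lam Q"

lemma prob_space_step: "prob_space (\<nu> i)"
proof -
  interpret E: prob_space "density lborel (exponential_density (lam i))"
    by (rule prob_space_exponential_density[OF lam_pos])
  interpret M: prob_space "measure_pmf (embed_pmf (\<lambda>j. Q $ i $ j))"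
    by (rule prob_space_measure_pmf)
  interpret pair_prob_space "density lborel (exponential_density (lam i))"
    "measure_pmf (embed_pmf (\<lambda>j. Q $ i $ j))" ..
  show ?thesis
    unfolding step_measure_def by (rule P.prob_space_axioms)
qed

lemma prob_space_entry: "prob_space \<mu>"
  unfolding entry_measure_def by (rule prob_space_PiM) (rule prob_space_step)

lemma prob_space_sample: "prob_space S"
  unfolding sample_measure_eq by (rule prob_space.prob_space_stream_space[OF prob_space_entry])

sublocale step: prob_space "\<nu> i" for i
  by (rule prob_space_step)

sublocale entry: prob_space \<mu>
  by (rule prob_space_entry)

sublocale sample: prob_space S
  by (rule prob_space_sample)

lemma distr_component: "distr \<mu> (\<nu> i) (\<lambda>y. y i) = \<nu> i"
  unfolding entry_measure_def by (rule distr_PiM_component) (auto intro: prob_space_step)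

lemma measurable_component_step: "(\<lambda>y. y i) \<in> \<mu> \<rightarrow>\<^sub>M \<nu> i"
  unfolding entry_measure_def by simp

lemma measurable_step_iff: "f \<in> \<nu> i \<rightarrow>\<^sub>M N \<longleftrightarrow> f \<in> borel \<Otimes>\<^sub>M count_space UNIV \<rightarrow>\<^sub>M N"
  by (simp add: measurable_cong_sets[OF sets_step_measure refl])

lemma integral_component:
  fixes G :: "real \<times> 'e \<Rightarrow> real"
  assumes "G \<in> borel_measurable (borel \<Otimes>\<^sub>M count_space UNIV)"
  shows "(\<integral>y. G (y i) \<partial>\<mu>) = (\<integral>z. G z \<partial>\<nu> i)"
  using integral_distr[OF measurable_component_step, of G i] assms
  by (simp add: distr_component measurable_step_iff)

lemma nn_integral_component:
  assumes "G \<in> borel_measurable (borel \<Otimes>\<^sub>M count_space UNIV)"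
  shows "(\<integral>\<^sup>+y. G (y i) \<partial>\<mu>) = (\<integral>\<^sup>+z. G z \<partial>\<nu> i)"
  using nn_integral_distr[OF measurable_component_step, of G i] assms
  by (simp add: distr_component measurable_step_iff)

lemma step_positive: "AE z in \<nu> i. 0 < fst z"
proof -
  interpret E: prob_space "density lborel (exponential_density (lam i))"
    by (rule prob_space_exponential_density[OF lam_pos])
  interpret M: prob_space "measure_pmf (embed_pmf (\<lambda>j. Q $ i $ j))"
    by (rule prob_space_measure_pmf)
  interpret pair_prob_space "density lborel (exponential_density (lam i))"
    "measure_pmf (embed_pmf (\<lambda>j. Q $ i $ j))" ..
  have "AE h in lborel. h \<noteq> (0::real)"
    by (rule AE_lborel_singleton)
  then have *: "AE h in density lborel (exponential_density (lam i)). 0 < h"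
    by (subst AE_density) (auto simp: exponential_density_def elim!: eventually_mono)
  show ?thesis
    unfolding step_measure_def
  proof (rule AE_pair_measure)
    show "{x \<in> space (density lborel (exponential_density (lam i)) \<Otimes>\<^sub>M measure_pmf (embed_pmf (($) (Q $ i)))). 0 < fst x}
        \<in> sets (density lborel (exponential_density (lam i)) \<Otimes>\<^sub>M measure_pmf (embed_pmf (($) (Q $ i))))"
      by measurable
    show "AE x in density lborel (exponential_density (lam i)).
        AE y in measure_pmf (embed_pmf (($) (Q $ i))). 0 < fst (x, y)"
      using * by simp
  qed
qed

lemma entry_positive: "AE y in \<mu>. 0 < fst (y i)"
  unfolding entry_measure_def by (rule AE_PiM_component) (auto intro: prob_space_step step_positive)

text \<open>The bound is asked only for positive holding times, which carry all the mass; discounts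
  such as \<open>exp (- w * h)\<close> with \<open>w > 0\<close> are unbounded over negative
  \<open>h\<close>.\<close>

lemma integrable_step:
  fixes G :: "real \<times> 'e \<Rightarrow> real"
  assumes "G \<in> borel_measurable (borel \<Otimes>\<^sub>M count_space UNIV)"
    and "\<And>z. 0 < fst z \<Longrightarrow> \<bar>G z\<bar> \<le> B"
  shows "integrable (\<nu> i) G"
proof (rule step.integrable_const_bound)
  show "AE z in \<nu> i. norm (G z) \<le> B"
    using step_positive[of i] by eventually_elim (use assms in auto)
  show "G \<in> borel_measurable (\<nu> i)"
    using assms(1) by (simp add: measurable_step_iff)
qed

text \<open>Holding time and next phase are independent, so by Fubini the phase is integrated first
  and the shift acts on a function of the exponential variable alone.\<close>

lemma memoryless:
  fixes G :: "real \<times> 'e \<Rightarrow> real"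
  assumes G [measurable]: "G \<in> borel_measurable (borel \<Otimes>\<^sub>M count_space UNIV)"
    and bound: "\<And>z. 0 < fst z \<Longrightarrow> \<bar>G z\<bar> \<le> B" and u: "0 \<le> u"
  shows "(\<integral>z. (if u < fst z then G (fst z - u, snd z) else 0) \<partial>\<nu> i) =
           exp (- lam i * u) * (\<integral>z. G z \<partial>\<nu> i)"
proof -
  interpret E: prob_space "density lborel (exponential_density (lam i))"
    by (rule prob_space_exponential_density[OF lam_pos])
  interpret M: prob_space "measure_pmf (embed_pmf (\<lambda>j. Q $ i $ j))"
    by (rule prob_space_measure_pmf)
  interpret pair_prob_space "density lborel (exponential_density (lam i))"
    "measure_pmf (embed_pmf (\<lambda>j. Q $ i $ j))" ..
  let ?E = "density lborel (exponential_density (lam i))"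
  let ?M = "measure_pmf (embed_pmf (\<lambda>j. Q $ i $ j))"
  have int1: "integrable (\<nu> i) G"
    using bound by (intro integrable_step[where B=B]) auto
  have int2: "integrable (\<nu> i) (\<lambda>z. if u < fst z then G (fst z - u, snd z) else 0)"
  proof (rule integrable_step)
    show "\<bar>if u < fst z then G (fst z - u, snd z) else 0\<bar> \<le> \<bar>B\<bar>" for z
      using bound[of "(fst z - u, snd z)"] by auto
  qed measurable
  have "(\<integral>z. (if u < fst z then G (fst z - u, snd z) else 0) \<partial>\<nu> i) =
          (\<integral>h. (\<integral>k. (if u < h then G (h - u, k) else 0) \<partial>?M) \<partial>?E)"
    using integral_fst'[OF int2[unfolded step_measure_def]] by (simp add: step_measure_def cong: if_cong)
  also have "\<dots> = (\<integral>h. (if u < h then (\<integral>k. G (h - u, k) \<partial>?M) else 0) \<partial>?E)"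
    by (rule Bochner_Integration.integral_cong) auto
  also have "\<dots> = exp (- lam i * u) * (\<integral>h. (\<integral>k. G (h, k) \<partial>?M) \<partial>?E)"
    by (rule integral_exponential_shift[OF lam_pos u]) measurable
  also have "(\<integral>h. (\<integral>k. G (h, k) \<partial>?M) \<partial>?E) = (\<integral>z. G z \<partial>\<nu> i)"
    using integral_fst'[OF int1[unfolded step_measure_def]] by (simp add: step_measure_def)
  finally show ?thesis .
qed

lemma integral_step_exp:
  assumes w: "0 < w"
  shows "(\<integral>z. exp (- w * fst z) \<partial>\<nu> i) = lam i / (lam i + w)"
proof -
  interpret E: prob_space "density lborel (exponential_density (lam i))"
    by (rule prob_space_exponential_density[OF lam_pos])
  interpret M: prob_space "measure_pmf (embed_pmf (\<lambda>j. Q $ i $ j))"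
    by (rule prob_space_measure_pmf)
  interpret pair_prob_space "density lborel (exponential_density (lam i))"
    "measure_pmf (embed_pmf (\<lambda>j. Q $ i $ j))" ..
  have "integrable (\<nu> i) (\<lambda>z. exp (- w * fst z))"
    using w by (intro integrable_step[where B=1]) auto
  from integral_fst'[OF this[unfolded step_measure_def]] show ?thesis
    using integral_exponential_exp[OF lam_pos w] by (simp add: step_measure_def)
qed

text \<open>Each \<open>lam i / (lam i + w)\<close> is the expected discount over one holding time.
  For \<open>w > 0\<close> the maximum over the finitely many phases is a uniform contraction factor
  below \<open>1\<close>.\<close>

definition discount_bound :: "real \<Rightarrow> real" where
  "discount_bound w = Max (range (\<lambda>i. lam i / (lam i + w)))"

lemma discount_bound_nonneg: "0 < w \<Longrightarrow> 0 \<le> discount_bound w"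
  using lam_pos
  by (auto simp: discount_bound_def Max_ge_iff add_nonneg_nonneg less_imp_le intro!: exI divide_nonneg_nonneg)

lemma discount_bound_less_1: "0 < w \<Longrightarrow> discount_bound w < 1"
  using lam_pos by (auto simp: discount_bound_def divide_less_eq add_pos_pos)

lemma integral_step_exp_le: "0 < w \<Longrightarrow> (\<integral>z. exp (- w * fst z) \<partial>\<nu> i) \<le> discount_bound w"
  by (subst integral_step_exp) (auto simp: discount_bound_def)

text \<open>The law of the stream is the image of \<open>\<mu> \<Otimes>\<^sub>M S\<close> under
  prepending, so the first entry is integrated separately from the tail. Almost surely the integrand
  reads only component \<open>i\<close> of that entry, whose marginal is \<open>\<nu> i\<close>. An
  almost sure identity suffices, so nonpositive holding times and explosive tails can be
  ignored.\<close>

lemma integral_sample_Stream: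
  fixes f :: "'e sample \<Rightarrow> real" and g :: "real \<times> 'e \<Rightarrow> 'e sample \<Rightarrow> real"
  assumes [measurable]: "f \<in> borel_measurable S"
    "case_prod g \<in> borel_measurable ((borel \<Otimes>\<^sub>M count_space UNIV) \<Otimes>\<^sub>M S)"
    and bound: "\<And>\<omega>. \<bar>f \<omega>\<bar> \<le> B"
    and eq: "AE y in \<mu>. AE s in S. f (y ## s) = g (y i) s"
  shows "(\<integral>\<omega>. f \<omega> \<partial>S) = (\<integral>z. (\<integral>s. g z s \<partial>S) \<partial>\<nu> i)"
proof -
  interpret pair_prob_space \<mu> S ..
  have "(\<lambda>z. (fst z i, snd z)) \<in> \<mu> \<Otimes>\<^sub>M S \<rightarrow>\<^sub>M (borel \<Otimes>\<^sub>M count_space UNIV) \<Otimes>\<^sub>M S"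
    by (intro measurable_Pair measurable_component[of _ _ lam Q]) simp_all
  from measurable_compose[OF this assms(2)]
  have [measurable]: "(\<lambda>(y, s). g (y i) s) \<in> borel_measurable (\<mu> \<Otimes>\<^sub>M S)"
    by (simp add: case_prod_unfold)
  have [measurable]: "(\<lambda>s. g (y i) s) \<in> borel_measurable S" for y :: "'e \<Rightarrow> real \<times> 'e"
    using measurable_Pair2[OF assms(2), of "y i"] by simp
  have int: "integrable (\<mu> \<Otimes>\<^sub>M S) (\<lambda>(y, s). f (y ## s))"
    by (intro P.integrable_const_bound[where B=B]) (auto simp: bound)
  have eq': "distr (\<mu> \<Otimes>\<^sub>M S) S (\<lambda>(y, s). y ## s) = S"
  proof (rule measure_eqI)
    fix A assume "A \<in> sets (distr (\<mu> \<Otimes>\<^sub>M S) S (\<lambda>(y, s). y ## s))"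
    then have [measurable]: "A \<in> sets S"
      by simp
    have "emeasure (distr (\<mu> \<Otimes>\<^sub>M S) S (\<lambda>(y, s). y ## s)) A =
            (\<integral>\<^sup>+z. indicator A ((\<lambda>(y, s). y ## s) z) \<partial>(\<mu> \<Otimes>\<^sub>M S))"
      by (subst nn_integral_indicator[symmetric], simp, subst nn_integral_distr) auto
    also have "\<dots> = (\<integral>\<^sup>+y. \<integral>\<^sup>+s. indicator A (y ## s) \<partial>S \<partial>\<mu>)"
      by (subst sample.nn_integral_fst[symmetric]) auto
    also have "\<dots> = (\<integral>\<^sup>+\<omega>. indicator A \<omega> \<partial>S)"
      using entry.nn_integral_stream_space[of "indicator A"] by (simp add: sample_measure_eq[symmetric])
    finally show "emeasure (distr (\<mu> \<Otimes>\<^sub>M S) S (\<lambda>(y, s). y ## s)) A = emeasure S A"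
      by simp
  qed simp
  have "(\<integral>\<omega>. f \<omega> \<partial>S) = (\<integral>\<omega>. f \<omega> \<partial>distr (\<mu> \<Otimes>\<^sub>M S) S (\<lambda>(y, s). y ## s))"
    by (simp add: eq')
  also have "\<dots> = (\<integral>z. f (fst z ## snd z) \<partial>(\<mu> \<Otimes>\<^sub>M S))"
    by (subst integral_distr) (auto simp: case_prod_beta)
  also have "\<dots> = (\<integral>y. (\<integral>s. f (y ## s) \<partial>S) \<partial>\<mu>)"
    using integral_fst'[OF int] by (simp add: case_prod_unfold)
  also have "\<dots> = (\<integral>y. (\<integral>s. g (y i) s \<partial>S) \<partial>\<mu>)"
  proof (rule integral_cong_AE)
    show "AE y in \<mu>. (\<integral>s. f (y ## s) \<partial>S) = (\<integral>s. g (y i) s \<partial>S)"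
      using eq
    proof eventually_elim
      case (elim y)
      show ?case
        by (rule integral_cong_AE) (use elim in auto)
    qed
  qed measurable
  also have "\<dots> = (\<integral>z. (\<integral>s. g z s \<partial>S) \<partial>\<nu> i)"
    by (rule integral_component) measurable
  finally show ?thesis .
qed

text \<open>With discount rate \<open>1\<close>, every holding time contributes a factor of at most
  \<open>discount_bound 1\<close>, whatever phase has been reached; hence the induction with
  \<open>i\<close> arbitrary. The geometric bound serves to exclude explosion.\<close>

lemma nn_integral_jump_time_le:
  "(\<integral>\<^sup>+\<omega>. ennreal (exp (- jump_time i \<omega> n)) \<partial>S) \<le> ennreal (discount_bound 1 ^ n)"
proof (induction n arbitrary: i)
  case 0
  show ?case
    using sample.emeasure_space_1 by (simp add: jump_time_def)
next
  case (Suc n)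
  have [measurable]: "(\<lambda>y. fst (y i)) \<in> borel_measurable \<mu>"
    by (rule measurable_compose[OF measurable_component[of _ _ lam Q]]) simp_all
  let ?r = "discount_bound 1"
  have r: "0 \<le> ?r"
    by (rule discount_bound_nonneg) simp
  have int: "integrable (\<nu> i) (\<lambda>z. exp (- 1 * fst z))"
    by (intro integrable_step[where B=1]) auto
  have "(\<integral>\<^sup>+\<omega>. ennreal (exp (- jump_time i \<omega> (Suc n))) \<partial>S) =
          (\<integral>\<^sup>+y. \<integral>\<^sup>+s. ennreal (exp (- jump_time i (y ## s) (Suc n))) \<partial>S \<partial>\<mu>)"
    using entry.nn_integral_stream_space[of "\<lambda>\<omega>. ennreal (exp (- jump_time i \<omega> (Suc n)))"]
    by (simp add: sample_measure_eq[symmetric])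
  also have "\<dots> = (\<integral>\<^sup>+y. \<integral>\<^sup>+s. ennreal (exp (- fst (y i))) * ennreal (exp (- jump_time (snd (y i)) s n)) \<partial>S \<partial>\<mu>)"
    by (simp add: jump_time_Stream exp_add ennreal_mult'[symmetric] exp_diff exp_minus divide_simps)
  also have "\<dots> = (\<integral>\<^sup>+y. ennreal (exp (- fst (y i))) * (\<integral>\<^sup>+s. ennreal (exp (- jump_time (snd (y i)) s n)) \<partial>S) \<partial>\<mu>)"
    by (intro nn_integral_cong nn_integral_cmult) simp
  also have "\<dots> \<le> (\<integral>\<^sup>+y. ennreal (exp (- fst (y i))) * ennreal (?r ^ n) \<partial>\<mu>)"
    by (intro nn_integral_mono mult_left_mono Suc) auto
  also have "\<dots> = (\<integral>\<^sup>+y. ennreal (exp (- 1 * fst (y i))) \<partial>\<mu>) * ennreal (?r ^ n)"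
    by (subst nn_integral_multc) auto
  also have "(\<integral>\<^sup>+y. ennreal (exp (- 1 * fst (y i))) \<partial>\<mu>) = ennreal (\<integral>z. exp (- 1 * fst z) \<partial>\<nu> i)"
    using nn_integral_component[of "\<lambda>z. ennreal (exp (- 1 * fst z))" i] nn_integral_eq_integral[OF int]
    by simp
  also have "\<dots> * ennreal (?r ^ n) \<le> ennreal ?r * ennreal (?r ^ n)"
    by (intro mult_right_mono ennreal_leI integral_step_exp_le) auto
  also have "\<dots> = ennreal (?r ^ Suc n)"
    using r by (simp add: ennreal_mult)
  finally show ?case .
qed

text \<open>The infimum over \<open>n\<close> of \<open>exp (- jump_time i \<omega> (Suc n))\<close>
  has expectation at most \<open>discount_bound 1 ^ Suc n\<close> for every \<open>n\<close>, so it
  is almost surely \<open>0\<close>. Being below \<open>exp (- t)\<close>, it yields a jump after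
  \<open>t\<close>. Null sets for different initial phases are united by countability.\<close>

lemma AE_nonexplosive: "AE \<omega> in S. \<forall>i. nonexplosive i \<omega>"
proof -
  have "AE \<omega> in S. nonexplosive i \<omega>" for i
  proof -
    let ?f = "\<lambda>\<omega>. INF n. ennreal (exp (- jump_time i \<omega> (Suc n)))"
    have r: "0 \<le> discount_bound 1" "discount_bound 1 < 1"
      by (auto intro: discount_bound_nonneg discount_bound_less_1)
    have "(\<integral>\<^sup>+\<omega>. ?f \<omega> \<partial>S) \<le> ennreal (discount_bound 1 ^ Suc n)" for n
      by (rule order_trans[OF nn_integral_mono nn_integral_jump_time_le]) (rule INF_lower, simp)
    moreover have "(\<lambda>n. ennreal (discount_bound 1 ^ Suc n)) \<longlonglongrightarrow> ennreal 0"
      using r by (intro tendsto_ennrealI LIMSEQ_Suc LIMSEQ_realpow_zero)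
    ultimately have "(\<integral>\<^sup>+\<omega>. ?f \<omega> \<partial>S) \<le> ennreal 0"
      by (intro LIMSEQ_le_const) auto
    then have "AE \<omega> in S. ?f \<omega> = 0"
      by (simp add: nn_integral_0_iff_AE)
    then show ?thesis
    proof eventually_elim
      case (elim \<omega>)
      show ?case
        unfolding nonexplosive_def
      proof
        fix t :: real
        have "?f \<omega> < ennreal (exp (- t))"
          using elim by simp
        then show "\<exists>n. t < jump_time i \<omega> (Suc n)"
          by (auto simp: INF_less_iff ennreal_less_iff)
      qed
    qed
  qed
  then show ?thesis
    by (intro AE_all_countable[THEN iffD2]) auto
qed

end

section \<open>The path and its discount relative to the first jump\<close>

lemma ereal_add_Inf: "ereal h + Inf A = (INF r\<in>A. ereal h + r)"
proof (rule antisym)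
  show "ereal h + Inf A \<le> (INF r\<in>A. ereal h + r)"
    by (intro INF_greatest add_left_mono Inf_lower)
  have "(INF r\<in>A. ereal h + r) - ereal h \<le> Inf A"
  proof (rule Inf_greatest)
    fix r assume "r \<in> A"
    then have "(INF r\<in>A. ereal h + r) \<le> r + ereal h"
      by (metis INF_lower add.commute)
    then show "(INF r\<in>A. ereal h + r) - ereal h \<le> r"
      by (simp add: ereal_minus_le)
  qed
  then show "(INF r\<in>A. ereal h + r) \<le> ereal h + Inf A"
    by (simp add: ereal_minus_le add.commute)
qed

lemma ereal_add_less_add_iff: "ereal h + r < ereal h + r' \<longleftrightarrow> r < r'"
  by (cases r; cases r') auto

text \<open>The first jump is counted once \<open>t\<close> has reached it, whence the
  \<open>Suc\<close>. Nonexplosion of the tail supplies the witness needed to shift the index under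
  \<open>LEAST\<close>.\<close>

lemma num_jumps_Stream:
  assumes "nonexplosive (snd (y i)) s"
  shows "num_jumps i (y ## s) t =
           (if t < fst (y i) then 0 else Suc (num_jumps (snd (y i)) s (t - fst (y i))))"
proof (cases "t < fst (y i)")
  case True
  then show ?thesis
    by (auto simp: num_jumps_def jump_time_Stream jump_time_def[of _ _ 0] intro: Least_equality)
next
  case False
  obtain n where "t - fst (y i) < jump_time (snd (y i)) s (Suc n)"
    using assms by (auto simp: nonexplosive_def)
  then have "t < jump_time i (y ## s) (Suc (Suc n))"
    by (subst jump_time_Stream) simp
  moreover have "\<not> t < jump_time i (y ## s) (Suc 0)"
    using False by (simp add: jump_time_Stream jump_time_def[of _ _ 0])
  ultimately have "(LEAST n. t < jump_time i (y ## s) (Suc n)) =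
      Suc (LEAST n. t < jump_time i (y ## s) (Suc (Suc n)))"
    by (rule Least_Suc)
  also have "(LEAST n. t < jump_time i (y ## s) (Suc (Suc n))) =
      (LEAST n. t - fst (y i) < jump_time (snd (y i)) s (Suc n))"
    by (subst jump_time_Stream) (simp add: less_diff_eq diff_less_eq add.commute)
  finally show ?thesis
    using False by (simp add: num_jumps_def)
qed

lemma nonexplosive_Stream:
  assumes "nonexplosive (snd (y i)) s"
  shows "nonexplosive i (y ## s)"
  unfolding nonexplosive_def
proof
  fix t
  obtain n where "t - fst (y i) < jump_time (snd (y i)) s (Suc n)"
    using assms by (auto simp: nonexplosive_def)
  then have "t < jump_time i (y ## s) (Suc (Suc n))"
    by (subst jump_time_Stream) simp
  then show "\<exists>n. t < jump_time i (y ## s) (Suc n)" ..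
qed

lemma level_Stream:
  assumes s: "nonexplosive (snd (y i)) s"
  shows "level c p x i (y ## s) t =
           (if t < fst (y i) then x + t / c i
            else level c p (p i * (x + fst (y i) / c i)) (snd (y i)) s (t - fst (y i)))"
proof -
  have "\<exists>n. t < jump_time i (y ## s) (Suc n)"
       "\<exists>n. t - fst (y i) < jump_time (snd (y i)) s (Suc n)"
    using s nonexplosive_Stream[where y=y and i=i, OF s] by (auto simp: nonexplosive_def)
  then show ?thesis
    unfolding level_def Let_def num_jumps_Stream[where y=y and i=i, OF s]
    by (auto simp del: chain_level.simps(2) chain_phase.simps(2)
        simp: chain_level_Stream chain_phase_Stream jump_time_Stream jump_time_def[of _ _ 0] diff_diff_eq)
qed

lemma phase_Stream:
  assumes s: "nonexplosive (snd (y i)) s"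
  shows "phase i (y ## s) t =
           (if t < fst (y i) then i else phase (snd (y i)) s (t - fst (y i)))"
proof -
  have "\<exists>n. t < jump_time i (y ## s) (Suc n)"
       "\<exists>n. t - fst (y i) < jump_time (snd (y i)) s (Suc n)"
    using s nonexplosive_Stream[where y=y and i=i, OF s] by (auto simp: nonexplosive_def)
  then show ?thesis
    unfolding phase_def num_jumps_Stream[where y=y and i=i, OF s]
    by (auto simp del: chain_phase.simps(2) simp: chain_phase_Stream)
qed

lemma hit_up_nonneg: "0 \<le> hit_up c p x i a \<omega>"
  and hit_down_nonneg: "0 \<le> hit_down c p x i b \<omega>"
  unfolding hit_up_def hit_down_def by (auto intro!: Inf_greatest)

text \<open>Discounts multiply because the exponent is additive in time. With
  \<open>0 \<le> \<tau>\<close> the evaluation time is not before the first jump, so the phase is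
  that of the restarted process; for infinite \<open>\<tau>\<close> both sides are
  \<open>0\<close>.\<close>

lemma discounted_Stream:
  assumes s: "nonexplosive (snd (y i)) s" and "0 \<le> \<tau>"
  shows "discounted w i j (ereal (fst (y i)) + \<tau>) (y ## s) =
           exp (- w * fst (y i)) * discounted w (snd (y i)) j \<tau> s"
  using assms(2)
  by (cases \<tau>) (auto simp: discounted_def phase_Stream[where y=y and i=i, OF s] algebra_simps mult_exp_exp)

lemma discounted_Stream_before_jump:
  assumes s: "nonexplosive (snd (y i)) s" and "u < fst (y i)"
  shows "discounted w i j (ereal u) (y ## s) = (if i = j then exp (- w * u) else 0)"
  using assms(2) by (auto simp: discounted_def phase_Stream[where y=y and i=i, OF s])

lemma abs_discounted_le_1:
  assumes "0 < w" "0 \<le> \<tau>"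
  shows "\<bar>discounted w i j \<tau> \<omega>\<bar> \<le> 1"
  using assms by (cases \<tau>) (auto simp: discounted_def)

section \<open>Passage times relative to the first jump\<close>

context fluid_model
begin

text \<open>Until the first jump the level rises from a value above \<open>b\<close>, so all times
  at level at most \<open>b\<close> are those of the restarted process, shifted by the holding time.
  \<open>Inf\<close> commutes with a finite shift, also for the empty set.\<close>

lemma hit_down_Stream:
  assumes s: "nonexplosive (snd (y i)) s" and "0 < fst (y i)" and "b < x"
  shows "hit_down c p x i b (y ## s) =
           ereal (fst (y i)) + hit_down c p (p i * (x + fst (y i) / c i)) (snd (y i)) b s"
proof -
  let ?h = "fst (y i)" and ?l = "level c p (p i * (x + fst (y i) / c i)) (snd (y i)) s"
  have "{ereal t |t. 0 \<le> t \<and> level c p x i (y ## s) t \<le> b} =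
          (\<lambda>r. ereal ?h + r) ` {ereal t |t. 0 \<le> t \<and> ?l t \<le> b}"
  proof (intro set_eqI iffI)
    fix r assume "r \<in> {ereal t |t. 0 \<le> t \<and> level c p x i (y ## s) t \<le> b}"
    then obtain t where t: "r = ereal t" "0 \<le> t" "level c p x i (y ## s) t \<le> b"
      by auto
    have "\<not> t < ?h"
    proof
      assume "t < ?h"
      then have "x + t / c i \<le> b"
        using t by (simp add: level_Stream[where y=y and i=i, OF s])
      moreover have "0 \<le> t / c i"
        using t c_pos[of i] by simp
      ultimately show False
        using assms by simp
    qed
    then show "r \<in> (\<lambda>r. ereal ?h + r) ` {ereal t |t. 0 \<le> t \<and> ?l t \<le> b}"
      using t by (intro image_eqI[of _ _ "ereal (t - ?h)"]) (auto simp: level_Stream[where y=y and i=i, OF s])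
  next
    fix r assume "r \<in> (\<lambda>r. ereal ?h + r) ` {ereal t |t. 0 \<le> t \<and> ?l t \<le> b}"
    then obtain t where "r = ereal (?h + t)" "0 \<le> t" "?l t \<le> b"
      by auto
    then show "r \<in> {ereal t |t. 0 \<le> t \<and> level c p x i (y ## s) t \<le> b}"
      using assms(2)
      by (intro CollectI exI[of _ "?h + t"]) (simp add: level_Stream[where y=y and i=i, OF s])
  qed
  then show ?thesis
    by (simp add: hit_down_def ereal_add_Inf)
qed

lemma hit_down_initial:
  assumes s: "nonexplosive (snd (y i)) s" and "0 < fst (y i)" and "x \<le> b"
  shows "hit_down c p x i b (y ## s) = 0"
proof (rule antisym[OF _ hit_down_nonneg])
  have "level c p x i (y ## s) 0 \<le> b"
    using assms by (simp add: level_Stream[where y=y and i=i, OF s])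
  then show "hit_down c p x i b (y ## s) \<le> 0"
    unfolding hit_down_def by (intro Inf_lower) (auto simp: zero_ereal_def)
qed

text \<open>Strictly before the first jump the level stays below \<open>a\<close>. The bound on the
  holding time may be non-strict: at equality the linear piece would reach \<open>a\<close> only at
  the jump instant, where the path already takes its post-jump value.\<close>

lemma hit_up_Stream:
  assumes s: "nonexplosive (snd (y i)) s" and "0 < fst (y i)" and "x < a"
    and le: "fst (y i) \<le> c i * (a - x)"
  shows "hit_up c p x i a (y ## s) =
           ereal (fst (y i)) + hit_up c p (p i * (x + fst (y i) / c i)) (snd (y i)) a s"
proof -
  let ?h = "fst (y i)" and ?l = "level c p (p i * (x + fst (y i) / c i)) (snd (y i)) s"
  have "{ereal t |t. 0 \<le> t \<and> a \<le> level c p x i (y ## s) t} =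
          (\<lambda>r. ereal ?h + r) ` {ereal t |t. 0 \<le> t \<and> a \<le> ?l t}"
  proof (intro set_eqI iffI)
    fix r assume "r \<in> {ereal t |t. 0 \<le> t \<and> a \<le> level c p x i (y ## s) t}"
    then obtain t where t: "r = ereal t" "0 \<le> t" "a \<le> level c p x i (y ## s) t"
      by auto
    have "\<not> t < ?h"
    proof
      assume "t < ?h"
      then have "a \<le> x + t / c i" "t < c i * (a - x)"
        using t le by (simp_all add: level_Stream[where y=y and i=i, OF s])
      then show False
        using c_pos[of i] by (simp add: field_simps)
    qed
    then show "r \<in> (\<lambda>r. ereal ?h + r) ` {ereal t |t. 0 \<le> t \<and> a \<le> ?l t}"
      using t by (intro image_eqI[of _ _ "ereal (t - ?h)"]) (auto simp: level_Stream[where y=y and i=i, OF s])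
  next
    fix r assume "r \<in> (\<lambda>r. ereal ?h + r) ` {ereal t |t. 0 \<le> t \<and> a \<le> ?l t}"
    then obtain t where "r = ereal (?h + t)" "0 \<le> t" "a \<le> ?l t"
      by auto
    then show "r \<in> {ereal t |t. 0 \<le> t \<and> a \<le> level c p x i (y ## s) t}"
      using assms(2)
      by (intro CollectI exI[of _ "?h + t"]) (simp add: level_Stream[where y=y and i=i, OF s])
  qed
  then show ?thesis
    by (simp add: hit_up_def ereal_add_Inf)
qed

text \<open>\<open>c i * (a - x)\<close> is the time needed to climb from \<open>x\<close> to
  \<open>a\<close> at slope \<open>1 / c i\<close>, and a longer holding time lets the first linear
  piece attain \<open>a\<close>.\<close>

lemma hit_up_before_jump:
  assumes s: "nonexplosive (snd (y i)) s" and "x < a" and less: "c i * (a - x) < fst (y i)"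
  shows "hit_up c p x i a (y ## s) = ereal (c i * (a - x))"
proof (rule antisym)
  have "0 \<le> c i * (a - x)" "level c p x i (y ## s) (c i * (a - x)) = a"
    using assms c_pos[of i] by (simp_all add: level_Stream[where y=y and i=i, OF s])
  then show "hit_up c p x i a (y ## s) \<le> ereal (c i * (a - x))"
    unfolding hit_up_def by (intro Inf_lower) auto
  show "ereal (c i * (a - x)) \<le> hit_up c p x i a (y ## s)"
    unfolding hit_up_def
  proof (rule Inf_greatest, clarsimp)
    fix t assume t: "a \<le> level c p x i (y ## s) t"
    show "c i * (a - x) \<le> t"
    proof (cases "t < fst (y i)")
      case True
      then show ?thesis
        using t c_pos[of i] by (simp add: level_Stream[where y=y and i=i, OF s] field_simps)
    qed (use less in simp)
  qed
qed

section \<open>Entries of the transforms as functions of the starting state, and their first-step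
  equations\<close>

definition down :: "real \<Rightarrow> real \<Rightarrow> 'e \<Rightarrow> real \<Rightarrow> 'e \<Rightarrow> real" where
  "down w b j x i = (\<integral>\<omega>. discounted w i j (hit_down c p x i b \<omega>) \<omega> \<partial>S)"

definition down_before :: "real \<Rightarrow> real \<Rightarrow> real \<Rightarrow> 'e \<Rightarrow> real \<Rightarrow> 'e \<Rightarrow> real" where
  "down_before w a b j x i =
     (\<integral>\<omega>. (if hit_down c p x i b \<omega> < hit_up c p x i a \<omega>
            then discounted w i j (hit_down c p x i b \<omega>) \<omega> else 0) \<partial>S)"

definition up_before :: "real \<Rightarrow> real \<Rightarrow> real \<Rightarrow> 'e \<Rightarrow> real \<Rightarrow> 'e \<Rightarrow> real" where
  "up_before w b a j x i =
     (\<integral>\<omega>. (if hit_up c p x i a \<omega> < hit_down c p x i b \<omega>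
            then discounted w i j (hit_up c p x i a \<omega>) \<omega> else 0) \<partial>S)"

text \<open>Joint dependence on level and phase matters because the first-step equations integrate
  this function at the random state just after the first jump.\<close>

lemma measurable_down [measurable (raw)]:
  assumes [measurable]: "x \<in> borel_measurable N" "k \<in> N \<rightarrow>\<^sub>M count_space UNIV"
  shows "(\<lambda>z. down w b j (x z) (k z)) \<in> borel_measurable N"
  unfolding down_def by measurable

lemma measurable_down_before [measurable (raw)]:
  assumes [measurable]: "x \<in> borel_measurable N" "k \<in> N \<rightarrow>\<^sub>M count_space UNIV"
  shows "(\<lambda>z. down_before w a b j (x z) (k z)) \<in> borel_measurable N"
  unfolding down_before_def by measurable

lemma measurable_up_before [measurable (raw)]:
  assumes [measurable]: "x \<in> borel_measurable N" "k \<in> N \<rightarrow>\<^sub>M count_space UNIV"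
  shows "(\<lambda>z. up_before w b a j (x z) (k z)) \<in> borel_measurable N"
  unfolding up_before_def by measurable

lemma abs_expectation_le_1:
  assumes "f \<in> borel_measurable S" "\<And>\<omega>. \<bar>f \<omega>\<bar> \<le> (1::real)"
  shows "\<bar>\<integral>\<omega>. f \<omega> \<partial>S\<bar> \<le> 1"
proof -
  have "norm (\<integral>\<omega>. f \<omega> \<partial>S) \<le> (\<integral>\<omega>. norm (f \<omega>) \<partial>S)"
    by (rule integral_norm_bound)
  also have "\<dots> \<le> (\<integral>\<omega>. 1 \<partial>S)"
    using assms by (intro integral_mono sample.integrable_const_bound[where B=1]) auto
  finally show ?thesis
    using sample.prob_space by simp
qed

lemma abs_down_le_1: "0 < w \<Longrightarrow> \<bar>down w b j x i\<bar> \<le> 1"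
  unfolding down_def
  by (intro abs_expectation_le_1) (auto intro!: abs_discounted_le_1 hit_down_nonneg)

lemma abs_down_before_le_1: "0 < w \<Longrightarrow> \<bar>down_before w a b j x i\<bar> \<le> 1"
  unfolding down_before_def
  by (intro abs_expectation_le_1) (auto intro!: abs_discounted_le_1 hit_down_nonneg)

lemma abs_up_before_le_1: "0 < w \<Longrightarrow> \<bar>up_before w b a j x i\<bar> \<le> 1"
  unfolding up_before_def
  by (intro abs_expectation_le_1) (auto intro!: abs_discounted_le_1 hit_up_nonneg)

text \<open>Discards the null sets of nonpositive first holding times and of explosive tails, which
  leaves a purely pathwise claim.\<close>

lemma AE_Stream:
  assumes "\<And>y s. 0 < fst (y i) \<Longrightarrow> nonexplosive (snd (y i)) s \<Longrightarrow> P y s"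
  shows "AE y in \<mu>. AE s in S. P y s"
  using entry_positive[of i]
proof eventually_elim
  case (elim y)
  show ?case
    using AE_nonexplosive by eventually_elim (use assms elim in auto)
qed

lemma down_step:
  assumes w: "0 < w" and "b < x"
  shows "down w b j x i =
           (\<integral>z. exp (- w * fst z) * down w b j (p i * (x + fst z / c i)) (snd z) \<partial>\<nu> i)"
proof -
  let ?g = "\<lambda>z s. exp (- w * fst z) *
    discounted w (snd z) j (hit_down c p (p i * (x + fst z / c i)) (snd z) b s) s"
  have "down w b j x i = (\<integral>z. (\<integral>s. ?g z s \<partial>S) \<partial>\<nu> i)"
    unfolding down_def
  proof (rule integral_sample_Stream[where B=1])
    show "AE y in \<mu>. AE s in S. discounted w i j (hit_down c p x i b (y ## s)) (y ## s) = ?g (y i) s"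
      by (rule AE_Stream[of i]) (use assms in \<open>simp add: hit_down_Stream discounted_Stream hit_down_nonneg\<close>)
  qed (use w in \<open>auto intro!: abs_discounted_le_1 hit_down_nonneg\<close>)
  then show ?thesis
    by (simp add: down_def)
qed

text \<open>Reaching \<open>a\<close> before the first jump excludes an earlier passage to
  \<open>b\<close>, which cannot occur before that jump. Otherwise both passage times are shifted by
  the same holding time and keep their order.\<close>

lemma down_before_step:
  assumes w: "0 < w" and x: "b < x" "x < a"
  shows "down_before w a b j x i =
           (\<integral>z. (if fst z \<le> c i * (a - x)
                then exp (- w * fst z) * down_before w a b j (p i * (x + fst z / c i)) (snd z)
                else 0) \<partial>\<nu> i)"
proof -
  let ?g = "\<lambda>z s. if fst z \<le> c i * (a - x)
    then exp (- w * fst z) *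
      (if hit_down c p (p i * (x + fst z / c i)) (snd z) b s < hit_up c p (p i * (x + fst z / c i)) (snd z) a s
       then discounted w (snd z) j (hit_down c p (p i * (x + fst z / c i)) (snd z) b s) s else 0)
    else 0"
  have "down_before w a b j x i = (\<integral>z. (\<integral>s. ?g z s \<partial>S) \<partial>\<nu> i)"
    unfolding down_before_def
  proof (rule integral_sample_Stream[where B=1])
    show "AE y in \<mu>. AE s in S.
       (if hit_down c p x i b (y ## s) < hit_up c p x i a (y ## s)
        then discounted w i j (hit_down c p x i b (y ## s)) (y ## s) else 0) = ?g (y i) s"
    proof (rule AE_Stream[of i])
      fix y :: "'e \<Rightarrow> real \<times> 'e" and s
      assume h: "0 < fst (y i)" and s: "nonexplosive (snd (y i)) s"
      show "(if hit_down c p x i b (y ## s) < hit_up c p x i a (y ## s)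
          then discounted w i j (hit_down c p x i b (y ## s)) (y ## s) else 0) = ?g (y i) s"
      proof (cases "fst (y i) \<le> c i * (a - x)")
        case True
        then show ?thesis
          by (simp add: hit_down_Stream[where y=y and i=i, OF s h x(1)] hit_up_Stream[where y=y and i=i, OF s h x(2)] discounted_Stream[where y=y and i=i, OF s]
              hit_down_nonneg ereal_add_less_add_iff)
      next
        case False
        then have "hit_up c p x i a (y ## s) \<le> hit_down c p x i b (y ## s)"
          using hit_down_nonneg[of c p "p i * (x + fst (y i) / c i)" "snd (y i)" b s]
          by (simp add: hit_down_Stream[where y=y and i=i, OF s h x(1)] hit_up_before_jump[where y=y and i=i, OF s x(2)] add_increasing2)
        then show ?thesis
          using False by auto
      qed
    qed
  qed (use w in \<open>auto intro!: abs_discounted_le_1 hit_down_nonneg\<close>)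
  also have "\<dots> = (\<integral>z. (if fst z \<le> c i * (a - x)
                then exp (- w * fst z) * down_before w a b j (p i * (x + fst z / c i)) (snd z)
                else 0) \<partial>\<nu> i)"
    by (intro Bochner_Integration.integral_cong) (auto simp: down_before_def)
  finally show ?thesis .
qed

text \<open>If the holding time exceeds the climbing time, \<open>a\<close> is reached at a
  deterministic time, in the initial phase and ahead of any passage to \<open>b\<close>; this is the
  explicit term. Otherwise the comparison of the passage times is passed on to the restarted
  process.\<close>

lemma up_before_step:
  assumes w: "0 < w" and x: "b < x" "x < a"
  shows "up_before w b a j x i =
           (\<integral>z. (if fst z \<le> c i * (a - x)
                then exp (- w * fst z) * up_before w b a j (p i * (x + fst z / c i)) (snd z)
                else if i = j then exp (- w * (c i * (a - x))) else 0) \<partial>\<nu> i)"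
proof -
  let ?g = "\<lambda>z s. if fst z \<le> c i * (a - x)
    then exp (- w * fst z) *
      (if hit_up c p (p i * (x + fst z / c i)) (snd z) a s < hit_down c p (p i * (x + fst z / c i)) (snd z) b s
       then discounted w (snd z) j (hit_up c p (p i * (x + fst z / c i)) (snd z) a s) s else 0)
    else if i = j then exp (- w * (c i * (a - x))) else 0"
  have "up_before w b a j x i = (\<integral>z. (\<integral>s. ?g z s \<partial>S) \<partial>\<nu> i)"
    unfolding up_before_def
  proof (rule integral_sample_Stream[where B=1])
    show "AE y in \<mu>. AE s in S.
       (if hit_up c p x i a (y ## s) < hit_down c p x i b (y ## s)
        then discounted w i j (hit_up c p x i a (y ## s)) (y ## s) else 0) = ?g (y i) s"
    proof (rule AE_Stream[of i])
      fix y :: "'e \<Rightarrow> real \<times> 'e" and s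
      assume h: "0 < fst (y i)" and s: "nonexplosive (snd (y i)) s"
      show "(if hit_up c p x i a (y ## s) < hit_down c p x i b (y ## s)
          then discounted w i j (hit_up c p x i a (y ## s)) (y ## s) else 0) = ?g (y i) s"
      proof (cases "fst (y i) \<le> c i * (a - x)")
        case True
        then show ?thesis
          by (simp add: hit_down_Stream[where y=y and i=i, OF s h x(1)] hit_up_Stream[where y=y and i=i, OF s h x(2)] discounted_Stream[where y=y and i=i, OF s]
              hit_up_nonneg ereal_add_less_add_iff)
      next
        case False
        then have less: "c i * (a - x) < fst (y i)"
          by simp
        then have "ereal (c i * (a - x)) < ereal (fst (y i))"
          by simp
        also have "\<dots> \<le> hit_down c p x i b (y ## s)"
          using hit_down_nonneg[of c p "p i * (x + fst (y i) / c i)" "snd (y i)" b s]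
          by (simp add: hit_down_Stream[where y=y and i=i, OF s h x(1)] add_increasing2)
        finally show ?thesis
          using False
          by (simp add: hit_up_before_jump[where y=y and i=i, OF s x(2) less] discounted_Stream_before_jump[where y=y and i=i, OF s less])
      qed
    qed
  qed (use w in \<open>auto intro!: abs_discounted_le_1 hit_up_nonneg\<close>)
  also have "\<dots> = (\<integral>z. (if fst z \<le> c i * (a - x)
                then exp (- w * fst z) * up_before w b a j (p i * (x + fst z / c i)) (snd z)
                else if i = j then exp (- w * (c i * (a - x))) else 0) \<partial>\<nu> i)"
    using sample.prob_space by (intro Bochner_Integration.integral_cong) (auto simp: up_before_def)
  finally show ?thesis .
qed

lemma hit_up_positive:
  assumes "nonexplosive (snd (y i)) s" "0 < fst (y i)" "x < a"
  shows "0 < hit_up c p x i a (y ## s)"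
proof (cases "fst (y i) \<le> c i * (a - x)")
  case True
  have "0 < ereal (fst (y i))"
    using assms by simp
  also have "\<dots> \<le> hit_up c p x i a (y ## s)"
    unfolding hit_up_Stream[where y=y and i=i, OF assms True]
    by (rule add_increasing2[OF hit_up_nonneg order_refl])
  finally show ?thesis .
next
  case False
  then show ?thesis
    using assms c_pos[of i] by (simp add: hit_up_before_jump)
qed

text \<open>Almost surely, passage down is immediate and passage up takes positive time. These are
  the boundary values for the first-step equations; levels strictly below \<open>b\<close> are
  included because a jump may carry the process past \<open>b\<close>.\<close>

lemma below_initial:
  assumes "x \<le> b" "x < a"
  shows "down_before w a b j x i = down w b j x i" and "up_before w b a j x i = 0"
proof -
  have "AE y in \<mu>. AE s in S. hit_down c p x i b (y ## s) = 0 \<and> 0 < hit_up c p x i a (y ## s)"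
    using assms by (intro AE_Stream[of i]) (simp add: hit_down_initial hit_up_positive)
  then have *: "AE \<omega> in S. hit_down c p x i b \<omega> = 0 \<and> 0 < hit_up c p x i a \<omega>"
    by (subst entry.AE_stream_space[folded sample_measure_eq]) measurable
  show "down_before w a b j x i = down w b j x i"
    unfolding down_before_def down_def
  proof (rule integral_cong_AE)
    show "AE \<omega> in S. (if hit_down c p x i b \<omega> < hit_up c p x i a \<omega>
        then discounted w i j (hit_down c p x i b \<omega>) \<omega> else 0) =
      discounted w i j (hit_down c p x i b \<omega>) \<omega>"
      using * by eventually_elim auto
  qed measurable
  have "up_before w b a j x i = (\<integral>\<omega>. 0 \<partial>S)"
    unfolding up_before_def
  proof (rule integral_cong_AE)
    show "AE \<omega> in S. (if hit_up c p x i a \<omega> < hit_down c p x i b \<omega>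
        then discounted w i j (hit_up c p x i a \<omega>) \<omega> else 0) = 0"
      using * by eventually_elim auto
  qed measurable
  then show "up_before w b a j x i = 0"
    by simp
qed

text \<open>By memorylessness, what remains of the first holding time once the level has reached \<open>a\<close> is
  distributed like a fresh holding time for the process started in \<open>(a, i)\<close>.\<close>

lemma first_step_split:
  assumes w: "0 < w" and x: "b < x" "x < a"
  shows "down w b j x i =
      (\<integral>z. (if fst z \<le> c i * (a - x)
           then exp (- w * fst z) * down w b j (p i * (x + fst z / c i)) (snd z) else 0) \<partial>\<nu> i)
      + exp (- (lam i + w) * (c i * (a - x))) * down w b j a i"
    and "up_before w b a k x i =
      (\<integral>z. (if fst z \<le> c i * (a - x)
           then exp (- w * fst z) * up_before w b a k (p i * (x + fst z / c i)) (snd z) else 0) \<partial>\<nu> i)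
      + exp (- (lam i + w) * (c i * (a - x))) * (if i = k then 1 else 0)"
proof -
  define u where "u = c i * (a - x)"
  have u: "0 \<le> u"
    using c_pos[of i] x by (simp add: u_def)
  have exp_u: "exp (- lam i * u) * exp (- w * u) = exp (- (lam i + w) * u)"
    by (simp add: mult_exp_exp algebra_simps)
  let ?d = "\<lambda>z. exp (- w * fst z) * down w b j (p i * (x + fst z / c i)) (snd z)"
  let ?G = "\<lambda>z. exp (- w * u) * (exp (- w * fst z) * down w b j (p i * (a + fst z / c i)) (snd z))"
  have exp_le: "exp (- w * h) \<le> 1" if "0 < h" for h
    using that w by simp
  have d_le: "\<bar>?d z\<bar> \<le> 1" if "0 < fst z" for z
    using exp_le[OF that] abs_down_le_1[OF w, of b j "p i * (x + fst z / c i)" "snd z"]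
    by (simp add: abs_mult mult_le_one)
  have "down w b j x i = (\<integral>z. ?d z \<partial>\<nu> i)"
    using down_step[OF w x(1)] .
  also have "\<dots> = (\<integral>z. (if fst z \<le> u then ?d z else 0) + (if u < fst z then ?d z else 0) \<partial>\<nu> i)"
    by (intro Bochner_Integration.integral_cong) auto
  also have "\<dots> = (\<integral>z. (if fst z \<le> u then ?d z else 0) \<partial>\<nu> i) + (\<integral>z. (if u < fst z then ?d z else 0) \<partial>\<nu> i)"
    using d_le
    by (intro Bochner_Integration.integral_add integrable_step[where B=1]) (auto simp: not_less)
  also have "(\<integral>z. (if u < fst z then ?d z else 0) \<partial>\<nu> i) =
      (\<integral>z. (if u < fst z then ?G (fst z - u, snd z) else 0) \<partial>\<nu> i)"
  proof -
    \<comment> \<open>Counted from the moment of reaching \<open>a\<close>, the jump comes after the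
      residual time \<open>h - u\<close>, and the level just before it is that of a path started in
      \<open>a\<close>. The discount splits at the same moment.\<close>
    have *: "x + h / c i = a + (h - u) / c i" for h
      using c_pos[of i] by (simp add: u_def field_simps)
    have **: "exp (- w * h) = exp (- w * u) * exp (- w * (h - u))" for h
      by (simp add: mult_exp_exp algebra_simps)
    have "?d z = ?G (fst z - u, snd z)" for z
      by (simp only: fst_conv snd_conv mult.assoc *[of "fst z"] **[of "fst z"])
    then show ?thesis
      by (intro Bochner_Integration.integral_cong refl if_cong)
  qed
  also have "\<dots> = exp (- lam i * u) * (\<integral>z. ?G z \<partial>\<nu> i)"
  proof (rule memoryless[OF _ _ u])
    fix z :: "real \<times> 'e" assume z: "0 < fst z"
    have "exp (- w * u) \<le> 1"
      using u w by simp
    then show "\<bar>?G z\<bar> \<le> 1"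
      using exp_le[OF z] abs_down_le_1[OF w, of b j "p i * (a + fst z / c i)" "snd z"]
      by (simp add: abs_mult mult_le_one)
  qed measurable
  also have "(\<integral>z. ?G z \<partial>\<nu> i) = exp (- w * u) * down w b j a i"
    using down_step[OF w, of b a j i] x by simp
  finally show "down w b j x i =
      (\<integral>z. (if fst z \<le> c i * (a - x)
           then exp (- w * fst z) * down w b j (p i * (x + fst z / c i)) (snd z) else 0) \<partial>\<nu> i)
      + exp (- (lam i + w) * (c i * (a - x))) * down w b j a i"
    using exp_u by (simp add: u_def flip: mult.assoc)
  let ?e = "\<lambda>z. exp (- w * fst z) * up_before w b a k (p i * (x + fst z / c i)) (snd z)"
  let ?C = "if i = k then exp (- w * u) else 0"
  have e_le: "\<bar>?e z\<bar> \<le> 1" if "0 < fst z" for z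
    using exp_le[OF that] abs_up_before_le_1[OF w, of b a k "p i * (x + fst z / c i)" "snd z"]
    by (simp add: abs_mult mult_le_one)
  have "up_before w b a k x i = (\<integral>z. (if fst z \<le> u then ?e z else ?C) \<partial>\<nu> i)"
    using up_before_step[where j=k and i=i, OF w x, folded u_def] .
  also have "\<dots> = (\<integral>z. (if fst z \<le> u then ?e z else 0) + (if u < fst z then ?C else 0) \<partial>\<nu> i)"
    by (intro Bochner_Integration.integral_cong) auto
  also have "\<dots> = (\<integral>z. (if fst z \<le> u then ?e z else 0) \<partial>\<nu> i) + (\<integral>z. (if u < fst z then ?C else 0) \<partial>\<nu> i)"
    using e_le u w
    by (intro Bochner_Integration.integral_add integrable_step[where B=1]) (auto simp: not_less)
  also have "(\<integral>z. (if u < fst z then ?C else 0) \<partial>\<nu> i) = exp (- lam i * u) * ?C"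
    \<comment> \<open>For a constant integrand, memorylessness reduces to the tail probability
      \<open>exp (- lam i * u)\<close> of the holding time.\<close>
    using memoryless[of "\<lambda>_. ?C" "\<bar>?C\<bar>" u i] u step.prob_space by simp
  also have "\<dots> = exp (- (lam i + w) * u) * (if i = k then 1 else 0)"
    unfolding exp_u[symmetric] by simp
  finally show "up_before w b a k x i =
      (\<integral>z. (if fst z \<le> c i * (a - x)
           then exp (- w * fst z) * up_before w b a k (p i * (x + fst z / c i)) (snd z) else 0) \<partial>\<nu> i)
      + exp (- (lam i + w) * (c i * (a - x))) * (if i = k then 1 else 0)"
    by (simp add: u_def)
qed

section \<open>The defect, right side minus left side of the identity at entry
  \<open>(i, j)\<close>, and its geometric decay\<close>

definition defect :: "real \<Rightarrow> real \<Rightarrow> real \<Rightarrow> 'e \<Rightarrow> real \<Rightarrow> 'e \<Rightarrow> real" where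
  "defect w a b j x i =
     down w b j x i - (\<Sum>k\<in>UNIV. up_before w b a k x i * down w b j a k) - down_before w a b j x i"

lemma measurable_defect [measurable (raw)]:
  assumes [measurable]: "x \<in> borel_measurable N" "k \<in> N \<rightarrow>\<^sub>M count_space UNIV"
  shows "(\<lambda>z. defect w a b j (x z) (k z)) \<in> borel_measurable N"
  unfolding defect_def by measurable

text \<open>Entries of the transforms are at most \<open>1\<close> in absolute value: two single
  terms and one product per phase. What matters is uniformity in \<open>x\<close> and
  \<open>i\<close>.\<close>

lemma abs_defect_le:
  assumes w: "0 < w"
  shows "\<bar>defect w a b j x i\<bar> \<le> 2 + real CARD('e)"
proof -
  have "\<bar>\<Sum>k\<in>UNIV. up_before w b a k x i * down w b j a k\<bar> \<le> (\<Sum>k\<in>(UNIV :: 'e set). 1)"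
    using abs_up_before_le_1[OF w] abs_down_le_1[OF w]
    by (intro order_trans[OF sum_abs] sum_mono) (simp add: abs_mult mult_le_one)
  then show ?thesis
    using abs_down_le_1[OF w, of b j x i] abs_down_before_le_1[OF w, of a b j x i]
    by (simp add: defect_def)
qed

text \<open>All three transforms satisfy the same linear recursion up to a term for crossing
  \<open>a\<close> before the jump. That term is the same for \<open>down\<close> and for the sum
  over phases and is absent for \<open>down_before\<close>, so it cancels.\<close>

lemma defect_step:
  assumes w: "0 < w" and x: "b < x" "x < a"
  shows "defect w a b j x i =
    (\<integral>z. (if fst z \<le> c i * (a - x)
         then exp (- w * fst z) * defect w a b j (p i * (x + fst z / c i)) (snd z) else 0) \<partial>\<nu> i)"
proof -
  \<comment> \<open>One discounted step on the event that \<open>a\<close> is not crossed before the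
    jump, as a linear operator in \<open>f\<close>.\<close>
  define L where "L f = (\<integral>z. (if fst z \<le> c i * (a - x)
    then exp (- w * fst z) * f (p i * (x + fst z / c i)) (snd z) else 0) \<partial>\<nu> i)" for f :: "real \<Rightarrow> 'e \<Rightarrow> real"
  define e where "e = exp (- (lam i + w) * (c i * (a - x)))"
  let ?s = "\<lambda>x i. \<Sum>k\<in>UNIV. up_before w b a k x i * down w b j a k"
  have int: "integrable (\<nu> i) (\<lambda>z. if fst z \<le> c i * (a - x)
      then exp (- w * fst z) * f (p i * (x + fst z / c i)) (snd z) else 0)"
    if [measurable]: "(\<lambda>z. f (p i * (x + fst z / c i)) (snd z)) \<in> borel_measurable (borel \<Otimes>\<^sub>M count_space UNIV)"
      and bound: "\<And>x k. \<bar>f x k\<bar> \<le> 1" for f :: "real \<Rightarrow> 'e \<Rightarrow> real"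
  proof (rule integrable_step)
    fix z :: "real \<times> 'e" assume "0 < fst z"
    then show "\<bar>if fst z \<le> c i * (a - x)
      then exp (- w * fst z) * f (p i * (x + fst z / c i)) (snd z) else 0\<bar> \<le> 1"
      using w bound[of "p i * (x + fst z / c i)" "snd z"] by (simp add: abs_mult mult_le_one)
  qed measurable
  \<comment> \<open>The phase is still \<open>i\<close> at the crossing, so only the summand
    \<open>k = i\<close> contributes a crossing term; linearity moves the finite sum inside
    \<open>L\<close>.\<close>
  have sum: "?s x i = L ?s + e * down w b j a i"
  proof -
    have "?s x i = (\<Sum>k\<in>UNIV. (L (up_before w b a k) + e * (if i = k then 1 else 0)) * down w b j a k)"
      using first_step_split(2)[OF w x] by (simp add: L_def e_def)
    also have "\<dots> = (\<Sum>k\<in>UNIV. L (up_before w b a k) * down w b j a k) + e * down w b j a i"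
    proof -
      have "e * (if i = k then 1 else 0) * down w b j a k = (if i = k then e * down w b j a i else 0)" for k
        by simp
      then show ?thesis
        by (simp add: distrib_right sum.distrib)
    qed
    also have "(\<Sum>k\<in>UNIV. L (up_before w b a k) * down w b j a k) = L ?s"
    proof -
      have "(\<Sum>k\<in>UNIV. L (up_before w b a k) * down w b j a k) =
        (\<integral>z. (\<Sum>k\<in>UNIV. (if fst z \<le> c i * (a - x)
           then exp (- w * fst z) * up_before w b a k (p i * (x + fst z / c i)) (snd z) else 0) *
             down w b j a k) \<partial>\<nu> i)"
        unfolding L_def using abs_up_before_le_1[OF w]
        by (subst Bochner_Integration.integral_sum) (auto intro!: integrable_mult_left int)
      also have "\<dots> = L ?s"
        unfolding L_def
        by (intro Bochner_Integration.integral_cong) (auto simp: sum_distrib_left mult.assoc)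
      finally show ?thesis .
    qed
    finally show ?thesis .
  qed
  have int_sum: "integrable (\<nu> i) (\<lambda>z. if fst z \<le> c i * (a - x)
      then exp (- w * fst z) * ?s (p i * (x + fst z / c i)) (snd z) else 0)"
  proof -
    have "integrable (\<nu> i) (\<lambda>z. \<Sum>k\<in>UNIV. (if fst z \<le> c i * (a - x)
           then exp (- w * fst z) * up_before w b a k (p i * (x + fst z / c i)) (snd z) else 0) *
             down w b j a k)"
      using abs_up_before_le_1[OF w] by (auto intro!: integrable_mult_left int)
    then show ?thesis
      by (rule Bochner_Integration.integrable_cong[THEN iffD1, rotated 2])
         (auto simp: sum_distrib_left mult.assoc)
  qed
  have "defect w a b j x i = L (down w b j) - L ?s - L (down_before w a b j)"
    using first_step_split(1)[OF w x, of j i] down_before_step[OF w x, of j i] sum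
    by (simp add: defect_def L_def e_def)
  also have "\<dots> = L (defect w a b j)"
  proof -
    have "L (down w b j) - L ?s - L (down_before w a b j) =
      (\<integral>z. (if fst z \<le> c i * (a - x)
        then exp (- w * fst z) * down w b j (p i * (x + fst z / c i)) (snd z) else 0) -
        (if fst z \<le> c i * (a - x)
        then exp (- w * fst z) * ?s (p i * (x + fst z / c i)) (snd z) else 0) -
        (if fst z \<le> c i * (a - x)
        then exp (- w * fst z) * down_before w a b j (p i * (x + fst z / c i)) (snd z) else 0) \<partial>\<nu> i)"
      unfolding L_def using abs_down_before_le_1[OF w] abs_down_le_1[OF w] int_sum
      by (subst Bochner_Integration.integral_diff,
          (intro Bochner_Integration.integrable_diff int int_sum; simp), (intro int; simp),
          subst Bochner_Integration.integral_diff, (intro int; simp)) auto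
    also have "\<dots> = L (defect w a b j)"
      unfolding L_def
      by (intro Bochner_Integration.integral_cong) (auto simp: defect_def right_diff_distrib)
    finally show ?thesis .
  qed
  finally show ?thesis
    by (simp add: L_def)
qed

text \<open>Each use of the homogeneous equation gains a factor \<open>discount_bound w\<close>, and
  at levels \<open>x \<le> b\<close> the defect is \<open>0\<close>. The claim covers all levels
  below \<open>a\<close> and all phases, since the induction hypothesis is needed at the state after
  the jump.\<close>

lemma abs_defect_le_power:
  assumes w: "0 < w" and ba: "0 < a" and x: "x < a"
  shows "\<bar>defect w a b j x i\<bar> \<le> discount_bound w ^ n * (2 + real CARD('e))"
  using x
proof (induction n arbitrary: x i)
  case 0
  then show ?case
    using abs_defect_le[OF w] by simp
next
  case (Suc n)
  let ?K = "discount_bound w ^ n * (2 + real CARD('e))"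
  have K: "0 \<le> ?K"
    using discount_bound_nonneg[OF w] by simp
  show ?case
  proof (cases "x \<le> b")
    case True
    then have "defect w a b j x i = 0"
      using Suc.prems by (simp add: defect_def below_initial)
    then show ?thesis
      using discount_bound_nonneg[OF w] by simp
  next
    case False
    let ?f = "\<lambda>z. if fst z \<le> c i * (a - x)
      then exp (- w * fst z) * defect w a b j (p i * (x + fst z / c i)) (snd z) else 0"
    have f_le: "\<bar>?f z\<bar> \<le> exp (- w * fst z) * ?K" for z
    proof (cases "fst z \<le> c i * (a - x)")
      case True
      \<comment> \<open>The induction hypothesis applies after the jump: a level of at most
        \<open>a\<close> is multiplied by \<open>p i < 1\<close>, and \<open>0 < a\<close> makes the
        result strictly smaller than \<open>a\<close>.\<close>
      then have "x + fst z / c i \<le> a"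
        using c_pos[of i] by (simp add: field_simps)
      then have "p i * (x + fst z / c i) \<le> p i * a"
        using p_pos[of i] by simp
      also have "\<dots> < a"
        using p_less_1[of i] ba by simp
      finally show ?thesis
        using True Suc.IH by (simp add: abs_mult)
    qed (use K in simp)
    have "\<bar>defect w a b j x i\<bar> = \<bar>\<integral>z. ?f z \<partial>\<nu> i\<bar>"
      using defect_step[OF w, of b x a j i] False Suc.prems by simp
    also have "\<dots> \<le> (\<integral>z. \<bar>?f z\<bar> \<partial>\<nu> i)"
      by (rule integral_abs_bound)
    also have "\<dots> \<le> (\<integral>z. exp (- w * fst z) * ?K \<partial>\<nu> i)"
    proof (rule integral_mono)
      have *: "exp (- w * fst z) * ?K \<le> ?K" if "0 < fst z" for z :: "real \<times> 'e"
        using that w K by (intro mult_left_le_one_le) auto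
      show "integrable (\<nu> i) (\<lambda>z. exp (- w * fst z) * ?K)"
      proof (rule integrable_step)
        fix z :: "real \<times> 'e" assume "0 < fst z"
        moreover have "0 \<le> exp (- w * fst z) * ?K"
          using K by simp
        ultimately show "\<bar>exp (- w * fst z) * ?K\<bar> \<le> ?K"
          using * by (simp only: abs_of_nonneg)
      qed measurable
      show "integrable (\<nu> i) (\<lambda>z. \<bar>?f z\<bar>)"
      proof (intro integrable_abs integrable_step)
        show "\<bar>?f z\<bar> \<le> ?K" if "0 < fst z" for z
          using f_le *[OF that] by (rule order_trans)
      qed measurable
    qed (rule f_le)
    also have "\<dots> = (\<integral>z. exp (- w * fst z) \<partial>\<nu> i) * ?K"
      by simp
    also have "\<dots> \<le> discount_bound w * ?K"
      by (intro mult_right_mono integral_step_exp_le w K)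
    finally show ?thesis
      by (simp add: mult.assoc)
  qed
qed

lemma defect_eq_0:
  assumes "0 < w" "0 < a" "x < a"
  shows "defect w a b j x i = 0"
proof -
  have "(\<lambda>n. discount_bound w ^ n * (2 + real CARD('e))) \<longlonglongrightarrow> 0 * (2 + real CARD('e))"
    using assms discount_bound_nonneg discount_bound_less_1
    by (intro tendsto_mult LIMSEQ_realpow_zero) auto
  then have "\<bar>defect w a b j x i\<bar> \<le> 0 * (2 + real CARD('e))"
    by (rule LIMSEQ_le_const) (use abs_defect_le_power[OF assms] in auto)
  then show ?thesis
    by simp
qed

end

theorem corollary5p4:
  fixes c lam p :: "'e::finite \<Rightarrow> real" and Q :: "real^'e^'e" and w a b x :: real
  assumes "\<And>i. 0 < c i" and "\<And>i. 0 < lam i" and "\<And>i. 0 < p i \<and> p i < 1"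
    and "stochastic_matrix Q"
    and "0 < w" and "0 \<le> b" and "b < a" and "b \<le> x" and "x < a"
  shows "Z_down_before c lam p Q w a x b =
           Z_down c lam p Q w x b - Z_up_before c lam p Q w b x a ** Z_down c lam p Q w a b"
proof -
  interpret fluid_model c lam p Q
    by unfold_locales (use assms in auto)
  \<comment> \<open>The matrix identity is read entry by entry; \<open>0 < a\<close> comes from
    \<open>0 \<le> b\<close> and \<open>b < a\<close>.\<close>
  have "defect w a b j x i = 0" for i j
    using assms by (intro defect_eq_0) auto
  then show ?thesis
    by (simp add: vec_eq_iff defect_def matrix_matrix_mult_def Z_down_def Z_up_before_def
        Z_down_before_def down_def up_before_def down_before_def)
qed

end
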